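(* Let $\mathcal{A}$ be a real (linear or affine) hyperplane arrangement with associated oriented system $(\Gamma,\sim)$, and let $\rho:(\Theta,\sim)\rightarrow(\Gamma,\sim)$ be a cover of oriented systems. The map $\Lambda_\rho:W_\rho\rightarrow W$ induced by $\rho$ is a topological cover of $W$.
   Context: **Arrangements.** $\mathcal{A}$ is a finite set of linear or affine hyperplanes in $\mathbb{R}^d$. $\mathcal{F}=\mathcal{F}(\mathcal{A})$ is its face poset: the set of all relatively open polyhedral cells of the stratification of $\mathbb{R}^d$ induced by $\mathcal{A}$, ordered by $F_1\ge F_2 \iff \overline{F_1}\subseteq\overline{F_2}$. The chambers $\mathcal{C}(\mathcal{A})$ (components of $\mathbb{R}^d\setminus\bigcup\mathcal{A}$) are the minimal elements. $|F|$ is the affine hull of $F$, and $\mathcal{A}_{|F|}=\{H\in\mathcal{A}: |F|\subseteq H\}$. For a face $F$ and chamber $C$, $C_F$ is the unique chamber of $\mathcal{A}$ whose closure contains $F$ and which lies in the same chamber of $\mathcal{A}_{|F|}$ as $C$. **Oriented systems.** In an oriented graph (edges are ordered pairs of vertices), a path is a sequence of edges with exponents $\pm1$ (traversed forward or backward), consecutive in the obvious sense; it is positive if all exponents are $+1$. An oriented system is an oriented graph together with an equivalence relation $\sim$ on its paths such that: $\alpha\sim\beta$ implies equal beginnings and equal ends; $\alpha\alpha^{-1}\sim begin(\alpha)$ (constant path); $\alpha\sim\beta$ implies $\alpha^{-1}\sim\beta^{-1}$; $\alpha\sim\beta$ implies $\gamma_1\alpha\gamma_2\sim\gamma_1\beta\gamma_2$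 whenever composable. All graphs are assumed connected. The oriented system $(\Gamma,\sim)$ of $\mathcal{A}$ has vertex set $\mathcal{C}(\mathcal{A})$, an edge $(A,B)$ for every ordered pair of adjacent chambers (separated by exactly one hyperplane), and $\sim$ is generated by identifying any two positive paths with the same beginning and end that both have minimal length among positive paths joining these vertices. A cover $\rho:(\Theta,\sim)\to(\Gamma,\sim)$ is a morphism of oriented graphs such that (1) for each vertex $v$ of $\Theta$ and each path $\alpha$ in $\Gamma$ with $begin(\alpha)=\rho(v)$ there is a unique path $\hat\alpha_v$ in $\Theta$ beginning at $v$ with $\rho(\hat\alpha_v)=\alpha$; (2) $\alpha\sim\beta$ and $begin(\alpha)=begin(\beta)=\rho(v)$ imply $\hat\alpha_v\sim\hat\beta_v$. For a vertex $v$ of $\Theta$ with $\rho(v)=A$, $\hat\gamma_v(A\to B)$ denotes the lift at $v$ of a positive minimal path from $A$ to $B$ (unique up to $\sim$; its end is well defined). **The complexes.** For a cover $\rho$, $\mathscr{D}_\rho$ is the diagram of spaces over $\mathcal{F}$ (functor with arrows $F_1\to F_2$ iff $F_1\ge F_2$) with discrete spaces $\mathscr{D}_\rho(F)=\{v\in V(\Theta):\rho(v)\le F\}$ and maps, for $F_1>F_2$, $v\mapsto end(\hat\gamma_v(\rho(v)\to\rho(v)_{F_2}))$. Its poset limit $\mathrm{Plim}\,\mathscr{D}_\rho$ is the set of pairs $(F,v)$ with $F\in\mathcal{F}$, $v\in\mathscr{D}_\rho(F)$, ordered by $(F_1,v_1)\ge(F_2,v_2)$ iff $F_1\ge F_2$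 and $v_2=end(\hat\gamma_{v_1}(\rho(v_1)\to\rho(v_1)_{F_2}))$. $W_\rho=\Delta(\mathrm{Plim}\,\mathscr{D}_\rho)$ is its order complex, and $W=W_{id}$ is the complex for the identity cover of $(\Gamma,\sim)$. $\Lambda_\rho:W_\rho\to W$ is the simplicial map given on vertices by $(F,v)\mapsto(F,\rho(v))$. *)

theory Defs
  imports "HOL-Analysis.Analysis" "Graph_Theory.Pair_Digraph"
begin

section \<open>Hyperplane arrangements\<close>

definition hyperplane :: "'a::euclidean_space set \<Rightarrow> bool" where
  "hyperplane H \<longleftrightarrow> (\<exists>a b. a \<noteq> 0 \<and> H = {x. a \<bullet> x = b})"

definition arrangement :: "'a::euclidean_space set set \<Rightarrow> bool" where
  "arrangement \<A> \<longleftrightarrow> finite \<A> \<and> (\<forall>H\<in>\<A>. hyperplane H)"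

text \<open>The two open half-spaces bounded by a hyperplane \<open>H\<close> are the connected components of its
  complement, so no choice of normal vectors is needed to speak of sides.\<close>

definition same_side :: "'a::euclidean_space set \<Rightarrow> 'a \<Rightarrow> 'a \<Rightarrow> bool" where
  "same_side H x y \<longleftrightarrow> x \<in> H \<and> y \<in> H \<or> connected_component (- H) x y"

definition faces :: "'a::euclidean_space set set \<Rightarrow> 'a set set" where
  "faces \<A> = range (\<lambda>x. {y. \<forall>H\<in>\<A>. same_side H x y})"

definition chambers :: "'a::euclidean_space set set \<Rightarrow> 'a set set" where
  "chambers \<A> = components (- \<Union>\<A>)"

text \<open>The order of the face poset: chambers are the minimal faces.\<close>

definition face_le :: "'a::euclidean_space set \<Rightarrow> 'a set \<Rightarrow> bool" where
  "face_le F\<^sub>2 F\<^sub>1 \<longleftrightarrow> closure F\<^sub>1 \<subseteq> closure F\<^sub>2"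

definition arrangement_at :: "'a::euclidean_space set set \<Rightarrow> 'a set \<Rightarrow> 'a set set" where
  "arrangement_at \<A> F = {H\<in>\<A>. affine hull F \<subseteq> H}"

definition chamber_at :: "'a::euclidean_space set set \<Rightarrow> 'a set \<Rightarrow> 'a set \<Rightarrow> 'a set" where
  "chamber_at \<A> C F = (THE D. D \<in> chambers \<A> \<and> F \<subseteq> closure D \<and>
     (\<exists>K\<in>chambers (arrangement_at \<A> F). C \<subseteq> K \<and> D \<subseteq> K))"

definition separates :: "'a::euclidean_space set \<Rightarrow> 'a set \<Rightarrow> 'a set \<Rightarrow> bool" where
  "separates H A B \<longleftrightarrow> (\<forall>x\<in>A. \<forall>y\<in>B. \<not> same_side H x y)"

section \<open>Oriented systems\<close>

text \<open>A path consists of its first vertex and a list of edges, each with a flag that is \<^const>\<open>True\<close>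
  for the exponent \<open>+1\<close> and \<^const>\<open>False\<close> for \<open>-1\<close>. Recording the first vertex accounts
  for the constant paths.\<close>

type_synonym 'v step = "('v \<times> 'v) \<times> bool"
type_synonym 'v opath = "'v \<times> 'v step list"

fun step_source :: "'v step \<Rightarrow> 'v" where
  "step_source ((a, b), s) = (if s then a else b)"

fun step_target :: "'v step \<Rightarrow> 'v" where
  "step_target ((a, b), s) = (if s then b else a)"

fun step_inverse :: "'v step \<Rightarrow> 'v step" where
  "step_inverse (e, s) = (e, \<not> s)"

fun is_walk :: "'v pair_pre_digraph \<Rightarrow> 'v \<Rightarrow> 'v step list \<Rightarrow> bool" where
  "is_walk G v [] \<longleftrightarrow> v \<in> pverts G"
| "is_walk G v (x # xs) \<longleftrightarrow>
     v \<in> pverts G \<and> fst x \<in> parcs G \<and> step_source x = v \<and> is_walk G (step_target x) xs"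

fun walk_end :: "'v \<Rightarrow> 'v step list \<Rightarrow> 'v" where
  "walk_end v [] = v"
| "walk_end v (x # xs) = walk_end (step_target x) xs"

definition opaths :: "'v pair_pre_digraph \<Rightarrow> 'v opath set" where
  "opaths G = {\<alpha>. is_walk G (fst \<alpha>) (snd \<alpha>)}"

definition path_begin :: "'v opath \<Rightarrow> 'v" where
  "path_begin \<alpha> = fst \<alpha>"

definition path_end :: "'v opath \<Rightarrow> 'v" where
  "path_end \<alpha> = walk_end (fst \<alpha>) (snd \<alpha>)"

definition path_length :: "'v opath \<Rightarrow> nat" where
  "path_length \<alpha> = length (snd \<alpha>)"

definition const_path :: "'v \<Rightarrow> 'v opath" where
  "const_path v = (v, [])"

definition path_inverse :: "'v opath \<Rightarrow> 'v opath" where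
  "path_inverse \<alpha> = (path_end \<alpha>, rev (map step_inverse (snd \<alpha>)))"

text \<open>Meaningful only if \<^term>\<open>path_end \<alpha> = path_begin \<beta>\<close>.\<close>

definition path_concat :: "'v opath \<Rightarrow> 'v opath \<Rightarrow> 'v opath" (infixr \<open>\<cdot>\<cdot>\<close> 65) where
  "\<alpha> \<cdot>\<cdot> \<beta> = (fst \<alpha>, snd \<alpha> @ snd \<beta>)"

definition positive_path :: "'v opath \<Rightarrow> bool" where
  "positive_path \<alpha> \<longleftrightarrow> (\<forall>x\<in>set (snd \<alpha>). snd x)"

definition map_path :: "('v \<Rightarrow> 'w) \<Rightarrow> 'v opath \<Rightarrow> 'w opath" where
  "map_path f \<alpha> = (f (fst \<alpha>), map (map_prod (map_prod f f) id) (snd \<alpha>))"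

definition minimal_positive :: "'v pair_pre_digraph \<Rightarrow> 'v \<Rightarrow> 'v \<Rightarrow> 'v opath \<Rightarrow> bool" where
  "minimal_positive G A B \<alpha> \<longleftrightarrow>
     \<alpha> \<in> opaths G \<and> positive_path \<alpha> \<and> path_begin \<alpha> = A \<and> path_end \<alpha> = B \<and>
     (\<forall>\<beta>\<in>opaths G. positive_path \<beta> \<and> path_begin \<beta> = A \<and> path_end \<beta> = B
        \<longrightarrow> path_length \<alpha> \<le> path_length \<beta>)"

definition graph_connected :: "'v pair_pre_digraph \<Rightarrow> bool" where
  "graph_connected G \<longleftrightarrow> pverts G \<noteq> {} \<and>
     (\<forall>u\<in>pverts G. \<forall>v\<in>pverts G. \<exists>\<alpha>\<in>opaths G. path_begin \<alpha> = u \<and> path_end \<alpha> = v)"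

definition path_congruence :: "'v pair_pre_digraph \<Rightarrow> 'v opath rel \<Rightarrow> bool" where
  "path_congruence G R \<longleftrightarrow>
     equiv (opaths G) R \<and>
     (\<forall>(\<alpha>, \<beta>)\<in>R. path_begin \<alpha> = path_begin \<beta> \<and> path_end \<alpha> = path_end \<beta>) \<and>
     (\<forall>\<alpha>\<in>opaths G. (\<alpha> \<cdot>\<cdot> path_inverse \<alpha>, const_path (path_begin \<alpha>)) \<in> R) \<and>
     (\<forall>(\<alpha>, \<beta>)\<in>R. (path_inverse \<alpha>, path_inverse \<beta>) \<in> R) \<and>
     (\<forall>(\<alpha>, \<beta>)\<in>R. \<forall>\<gamma>\<^sub>1\<in>opaths G. \<forall>\<gamma>\<^sub>2\<in>opaths G.
        path_end \<gamma>\<^sub>1 = path_begin \<alpha> \<and> path_end \<alpha> = path_begin \<gamma>\<^sub>2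
        \<longrightarrow> (\<gamma>\<^sub>1 \<cdot>\<cdot> \<alpha> \<cdot>\<cdot> \<gamma>\<^sub>2, \<gamma>\<^sub>1 \<cdot>\<cdot> \<beta> \<cdot>\<cdot> \<gamma>\<^sub>2) \<in> R)"

definition oriented_system :: "'v pair_pre_digraph \<Rightarrow> 'v opath rel \<Rightarrow> bool" where
  "oriented_system G R \<longleftrightarrow> pair_wf_digraph G \<and> graph_connected G \<and> path_congruence G R"

definition generated_congruence :: "'v pair_pre_digraph \<Rightarrow> 'v opath rel \<Rightarrow> 'v opath rel" where
  "generated_congruence G S = \<Inter>{R. path_congruence G R \<and> S \<subseteq> R}"

definition path_lift ::
  "'v pair_pre_digraph \<Rightarrow> ('v \<Rightarrow> 'w) \<Rightarrow> 'v \<Rightarrow> 'w opath \<Rightarrow> 'v opath" where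
  "path_lift \<Theta> \<rho> v \<alpha> = (THE \<beta>. \<beta> \<in> opaths \<Theta> \<and> path_begin \<beta> = v \<and> map_path \<rho> \<beta> = \<alpha>)"

definition oriented_cover ::
  "'v pair_pre_digraph \<Rightarrow> 'v opath rel \<Rightarrow> 'w pair_pre_digraph \<Rightarrow> 'w opath rel \<Rightarrow> ('v \<Rightarrow> 'w) \<Rightarrow> bool"
  where
  "oriented_cover \<Theta> R \<Gamma> S \<rho> \<longleftrightarrow>
     \<rho> ` pverts \<Theta> \<subseteq> pverts \<Gamma> \<and> map_prod \<rho> \<rho> ` parcs \<Theta> \<subseteq> parcs \<Gamma> \<and>
     (\<forall>v\<in>pverts \<Theta>. \<forall>\<alpha>\<in>opaths \<Gamma>. path_begin \<alpha> = \<rho> v \<longrightarrow>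
        (\<exists>!\<beta>. \<beta> \<in> opaths \<Theta> \<and> path_begin \<beta> = v \<and> map_path \<rho> \<beta> = \<alpha>)) \<and>
     (\<forall>v\<in>pverts \<Theta>. \<forall>(\<alpha>, \<beta>)\<in>S. path_begin \<alpha> = \<rho> v \<and> path_begin \<beta> = \<rho> v \<longrightarrow>
        (path_lift \<Theta> \<rho> v \<alpha>, path_lift \<Theta> \<rho> v \<beta>) \<in> R)"

section \<open>The oriented system of an arrangement\<close>

definition chamber_graph :: "'a::euclidean_space set set \<Rightarrow> 'a set pair_pre_digraph" where
  "chamber_graph \<A> =
     \<lparr>pverts = chambers \<A>,
      parcs = {(A, B). A \<in> chambers \<A> \<and> B \<in> chambers \<A> \<and> card {H\<in>\<A>. separates H A B} = 1}\<rparr>"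

definition chamber_path_rel :: "'a::euclidean_space set set \<Rightarrow> 'a set opath rel" where
  "chamber_path_rel \<A> = generated_congruence (chamber_graph \<A>)
     {(\<alpha>, \<beta>). \<exists>A B. minimal_positive (chamber_graph \<A>) A B \<alpha> \<and>
                     minimal_positive (chamber_graph \<A>) A B \<beta>}"

section \<open>The diagram of a cover and its poset limit\<close>

text \<open>The end of the lift at \<open>v\<close> of a positive minimal path from \<open>\<rho> v\<close> to \<open>B\<close>; for a cover
  it does not depend on the chosen path.\<close>

definition lift_end ::
  "'a::euclidean_space set set \<Rightarrow> 'v pair_pre_digraph \<Rightarrow> ('v \<Rightarrow> 'a set) \<Rightarrow> 'v \<Rightarrow> 'a set \<Rightarrow> 'v" where
  "lift_end \<A> \<Theta> \<rho> v B =
     path_end (path_lift \<Theta> \<rho> v (SOME \<alpha>. minimal_positive (chamber_graph \<A>) (\<rho> v) B \<alpha>))"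

definition diagram_space ::
  "'v pair_pre_digraph \<Rightarrow> ('v \<Rightarrow> 'a::euclidean_space set) \<Rightarrow> 'a set \<Rightarrow> 'v set" where
  "diagram_space \<Theta> \<rho> F = {v \<in> pverts \<Theta>. face_le (\<rho> v) F}"

definition diagram_map ::
  "'a::euclidean_space set set \<Rightarrow> 'v pair_pre_digraph \<Rightarrow> ('v \<Rightarrow> 'a set) \<Rightarrow> 'a set \<Rightarrow> 'v \<Rightarrow> 'v" where
  "diagram_map \<A> \<Theta> \<rho> F\<^sub>2 v = lift_end \<A> \<Theta> \<rho> v (chamber_at \<A> (\<rho> v) F\<^sub>2)"

definition Plim ::
  "'a::euclidean_space set set \<Rightarrow> 'v pair_pre_digraph \<Rightarrow> ('v \<Rightarrow> 'a set) \<Rightarrow> ('a set \<times> 'v) set" where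
  "Plim \<A> \<Theta> \<rho> = (SIGMA F:faces \<A>. diagram_space \<Theta> \<rho> F)"

definition Plim_order ::
  "'a::euclidean_space set set \<Rightarrow> 'v pair_pre_digraph \<Rightarrow> ('v \<Rightarrow> 'a set) \<Rightarrow> ('a set \<times> 'v) rel" where
  "Plim_order \<A> \<Theta> \<rho> =
     {((F\<^sub>2, v\<^sub>2), (F\<^sub>1, v\<^sub>1)). (F\<^sub>2, v\<^sub>2) \<in> Plim \<A> \<Theta> \<rho> \<and> (F\<^sub>1, v\<^sub>1) \<in> Plim \<A> \<Theta> \<rho> \<and>
        face_le F\<^sub>2 F\<^sub>1 \<and> v\<^sub>2 = diagram_map \<A> \<Theta> \<rho> F\<^sub>2 v\<^sub>1}"

section \<open>Order complexes and geometric realizations\<close>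

definition order_complex :: "'p set \<Rightarrow> 'p rel \<Rightarrow> 'p set set" where
  "order_complex P r = {\<sigma>. \<sigma> \<subseteq> P \<and> finite \<sigma> \<and> \<sigma> \<noteq> {} \<and> \<sigma> \<in> Chains r}"

text \<open>Points of the realization are given by their barycentric coordinates. The realization carries
  the weak topology, i.e. a set is open iff it meets every closed simplex in a relatively open
  set; on a single simplex the product topology of \<^typ>\<open>'p \<Rightarrow> real\<close> is the Euclidean one.\<close>

definition closed_simplex :: "'p set \<Rightarrow> ('p \<Rightarrow> real) set" where
  "closed_simplex \<sigma> = {t. (\<forall>p. 0 \<le> t p) \<and> (\<forall>p. p \<notin> \<sigma> \<longrightarrow> t p = 0) \<and> sum t \<sigma> = 1}"

definition realization :: "'p set set \<Rightarrow> ('p \<Rightarrow> real) topology" where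
  "realization K = topology (\<lambda>U. U \<subseteq> (\<Union>\<sigma>\<in>K. closed_simplex \<sigma>) \<and>
     (\<forall>\<sigma>\<in>K. openin (top_of_set (closed_simplex \<sigma>)) (U \<inter> closed_simplex \<sigma>)))"

lemma openin_realization:
  "openin (realization K) U \<longleftrightarrow> U \<subseteq> (\<Union>\<sigma>\<in>K. closed_simplex \<sigma>) \<and>
     (\<forall>\<sigma>\<in>K. openin (top_of_set (closed_simplex \<sigma>)) (U \<inter> closed_simplex \<sigma>))"
proof -
  have "istopology (\<lambda>U. U \<subseteq> (\<Union>\<sigma>\<in>K. closed_simplex \<sigma>) \<and>
     (\<forall>\<sigma>\<in>K. openin (top_of_set (closed_simplex \<sigma>)) (U \<inter> closed_simplex \<sigma>)))"
    unfolding istopology_def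
  proof (intro conjI allI impI ballI)
    fix S T \<sigma> assume "S \<subseteq> (\<Union>\<sigma>\<in>K. closed_simplex \<sigma>) \<and>
        (\<forall>\<sigma>\<in>K. openin (top_of_set (closed_simplex \<sigma>)) (S \<inter> closed_simplex \<sigma>))"
      and "T \<subseteq> (\<Union>\<sigma>\<in>K. closed_simplex \<sigma>) \<and>
        (\<forall>\<sigma>\<in>K. openin (top_of_set (closed_simplex \<sigma>)) (T \<inter> closed_simplex \<sigma>))" and "\<sigma> \<in> K"
    then have "openin (top_of_set (closed_simplex \<sigma>))
        ((S \<inter> closed_simplex \<sigma>) \<inter> (T \<inter> closed_simplex \<sigma>))"
      by (blast intro: openin_Int)
    then show "openin (top_of_set (closed_simplex \<sigma>)) (S \<inter> T \<inter> closed_simplex \<sigma>)"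
      by (simp add: Int_ac)
  next
    fix \<U> \<sigma> assume "\<forall>U\<in>\<U>. U \<subseteq> (\<Union>\<sigma>\<in>K. closed_simplex \<sigma>) \<and>
        (\<forall>\<sigma>\<in>K. openin (top_of_set (closed_simplex \<sigma>)) (U \<inter> closed_simplex \<sigma>))" and "\<sigma> \<in> K"
    then have "openin (top_of_set (closed_simplex \<sigma>)) (\<Union>U\<in>\<U>. U \<inter> closed_simplex \<sigma>)"
      by (intro openin_Union) blast
    then show "openin (top_of_set (closed_simplex \<sigma>)) (\<Union>\<U> \<inter> closed_simplex \<sigma>)"
      by simp
  qed blast+
  then show ?thesis
    by (simp add: realization_def)
qed

lemma topspace_realization: "topspace (realization K) = (\<Union>\<sigma>\<in>K. closed_simplex \<sigma>)"
proof -
  have "openin (realization K) (\<Union>\<sigma>\<in>K. closed_simplex \<sigma>)"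
    unfolding openin_realization
    by (auto simp: Int_absorb1 SUP_upper)
  moreover have "topspace (realization K) \<subseteq> (\<Union>\<sigma>\<in>K. closed_simplex \<sigma>)"
    using openin_realization openin_topspace by blast
  ultimately show ?thesis
    by (blast dest: openin_subset)
qed

text \<open>The affine extension of a vertex map \<open>f\<close>. The sum ranges over the support of \<open>t\<close>, which is
  finite at points of a realization.\<close>

definition realization_map :: "('p \<Rightarrow> 'q) \<Rightarrow> ('p \<Rightarrow> real) \<Rightarrow> 'q \<Rightarrow> real" where
  "realization_map f t q = sum t {p. t p \<noteq> 0 \<and> f p = q}"

definition W_complex ::
  "'a::euclidean_space set set \<Rightarrow> 'v pair_pre_digraph \<Rightarrow> ('v \<Rightarrow> 'a set) \<Rightarrow> ('a set \<times> 'v) set set" where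
  "W_complex \<A> \<Theta> \<rho> = order_complex (Plim \<A> \<Theta> \<rho>) (Plim_order \<A> \<Theta> \<rho>)"

definition Lambda ::
  "('v \<Rightarrow> 'a set) \<Rightarrow> ('a::euclidean_space set \<times> 'v \<Rightarrow> real) \<Rightarrow> ('a set \<times> 'a set \<Rightarrow> real)" where
  "Lambda \<rho> = realization_map (\<lambda>(F, v). (F, \<rho> v))"

section \<open>Covering maps of topological spaces\<close>

text \<open>This is \<^const>\<open>covering_space\<close> for \<^typ>\<open>'a topology\<close>; the type-class based constant does
  not apply, because the weak topology is not the topology of the type \<^typ>\<open>'p \<Rightarrow> real\<close>.\<close>

definition covering_map :: "'a topology \<Rightarrow> 'b topology \<Rightarrow> ('a \<Rightarrow> 'b) \<Rightarrow> bool" where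
  "covering_map X Y p \<longleftrightarrow>
     continuous_map X Y p \<and> p ` topspace X = topspace Y \<and>
     (\<forall>y\<in>topspace Y. \<exists>T. y \<in> T \<and> openin Y T \<and>
        (\<exists>\<V>. \<Union>\<V> = topspace X \<inter> p -` T \<and>
             (\<forall>U\<in>\<V>. openin X U) \<and>
             pairwise disjnt \<V> \<and>
             (\<forall>U\<in>\<V>. homeomorphic_map (subtopology X U) (subtopology Y T) p)))"

end

theory Submission
  imports Defs
begin

text \<open>A simplicial map that is injective on simplices and lifts every simplex uniquely through a
  prescribed vertex restricts to homeomorphisms between open stars, and is therefore a covering.
  For order complexes this reduces to unique lifting of comparabilities. In the poset limit of a
  cover, relations below \<open>(F, v)\<close> lift by lifting positive minimal paths at \<open>v\<close>, and relations
  above it by lifting their inverses. Transitivity is the geometric input: if \<open>F\<^sub>1 \<le> F\<^sub>2\<close>, then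
  the hyperplanes separating \<open>C\<close> from \<open>C_F\<^sub>2\<close> avoid \<open>F\<^sub>2\<close>, while those separating \<open>C_F\<^sub>2\<close> from
  \<open>C_F\<^sub>1\<close> contain it. As the length of a positive minimal path is the number of separating
  hyperplanes, minimal paths \<open>C \<rightarrow> C_F\<^sub>2 \<rightarrow> C_F\<^sub>1\<close> compose to a minimal path.\<close>

section \<open>Simplicial coverings\<close>

text \<open>The weak topology turns openness into a question about one simplex at a time. A base
  simplex through \<open>f p\<close> has exactly one lift through p, and on it the inverse of the
  affine map only renames coordinates; hence infinite covers cause no extra trouble.

  The geometry is carried by sign vectors. At each hyperplane the chamber C_F has the sign of F if
  that is nonzero, and the sign of C otherwise: this is the composition of covectors known from
  oriented matroids. Compatibility of C_F along F and the count of separating hyperplanes can then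
  be checked one hyperplane at a time.

  The length formula meets one obstacle: a segment joining two chambers may cross several
  hyperplanes at once. The starting points for which two given crossings coincide satisfy one
  nontrivial linear equation, so finitely many null sets have to be avoided inside an open chamber.

  The diagram maps point downwards. A relation below \<open>(F, v)\<close> is therefore found by
  applying a map to v, whereas a relation above asks for a preimage of v over a prescribed
  chamber.\<close>

lemma sum_closed_simplex_superset:
  assumes "t \<in> closed_simplex \<sigma>" "{p. t p \<noteq> 0} \<subseteq> \<sigma>'" "finite \<sigma>" "finite \<sigma>'"
  shows "sum t \<sigma>' = 1"
proof -
  have "sum t \<sigma>' = sum t {p. t p \<noteq> 0}"
    using assms by (intro sum.mono_neutral_right) auto
  also have "\<dots> = sum t \<sigma>"
    using assms by (intro sum.mono_neutral_left) (auto simp: closed_simplex_def)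
  finally show ?thesis
    using assms(1) by (simp add: closed_simplex_def)
qed

text \<open>Injectivity leaves at most one vertex of the support over \<open>f p\<close>, so the
  defining sum has at most one term: on a simplex the affine map only renames coordinates.\<close>

lemma realization_map_vertex:
  assumes "inj_on f \<sigma>" "t \<in> closed_simplex \<sigma>" "p \<in> \<sigma>"
  shows "realization_map f t (f p) = t p"
proof -
  have "{p'. t p' \<noteq> 0 \<and> f p' = f p} = (if t p = 0 then {} else {p})"
    using assms by (auto simp: closed_simplex_def inj_on_def)
  then show ?thesis
    by (simp add: realization_map_def)
qed

lemma realization_map_outside:
  assumes "t \<in> closed_simplex \<sigma>" "q \<notin> f ` \<sigma>"
  shows "realization_map f t q = 0"
proof -
  have "{p. t p \<noteq> 0 \<and> f p = q} = {}"
    using assms by (auto simp: closed_simplex_def)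
  then show ?thesis
    by (simp only: realization_map_def sum.empty)
qed

lemma realization_map_closed_simplex:
  assumes "inj_on f \<sigma>" "t \<in> closed_simplex \<sigma>"
  shows "realization_map f t \<in> closed_simplex (f ` \<sigma>)"
proof -
  have "0 \<le> realization_map f t q" for q
    unfolding realization_map_def using assms(2) by (auto simp: closed_simplex_def intro: sum_nonneg)
  moreover have "sum (realization_map f t) (f ` \<sigma>) = sum t \<sigma>"
    using assms by (simp add: sum.reindex realization_map_vertex cong: sum.cong)
  ultimately show ?thesis
    using assms(2) realization_map_outside[OF assms(2), where f = f]
    by (simp add: closed_simplex_def)
qed

text \<open>A common form for the affine map on a simplex and for its inverse: each new coordinate
  is either a copy of an old one or, at \<open>None\<close>, zero.\<close>

lemma continuous_on_coordinate_map:
  fixes g :: "'q \<Rightarrow> 'p option"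
  shows "continuous_on S (\<lambda>t q. case g q of Some p \<Rightarrow> t p | None \<Rightarrow> (0 :: real))"
proof (rule continuous_on_coordinatewise_then_product)
  fix q
  show "continuous_on S (\<lambda>t. case g q of Some p \<Rightarrow> t p | None \<Rightarrow> (0 :: real))"
    by (cases "g q") (auto intro: continuous_on_subset[OF continuous_on_product_coordinates])
qed

lemma continuous_on_realization_map:
  assumes "inj_on f \<sigma>"
  shows "continuous_on (closed_simplex \<sigma>) (realization_map f)"
proof -
  define g where "g q = (if q \<in> f ` \<sigma> then Some (inv_into \<sigma> f q) else None)" for q
  have "realization_map f t q = (case g q of Some p \<Rightarrow> t p | None \<Rightarrow> 0)"
    if "t \<in> closed_simplex \<sigma>" for t q
  proof (cases "q \<in> f ` \<sigma>")
    case True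
    then show ?thesis
      using realization_map_vertex[OF assms that inv_into_into[OF True]]
      by (simp add: g_def f_inv_into_f)
  qed (simp add: g_def realization_map_outside[OF that])
  then have "realization_map f t = (\<lambda>q. case g q of Some p \<Rightarrow> t p | None \<Rightarrow> 0)"
    if "t \<in> closed_simplex \<sigma>" for t
    using that by blast
  then show ?thesis
    using continuous_on_coordinate_map[of "closed_simplex \<sigma>" g] by (simp cong: continuous_on_cong)
qed

text \<open>\<open>simplex_lift\<close> says that f maps the simplices through p bijectively onto
  those through \<open>f p\<close>; it is the combinatorial counterpart of being evenly
  covered.\<close>

locale simplicial_covering =
  fixes K :: "'p set set" and L :: "'q set set" and f :: "'p \<Rightarrow> 'q"
  assumes finite_simplex: "\<sigma> \<in> K \<Longrightarrow> finite \<sigma>"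
    and face_closed: "\<sigma> \<in> K \<Longrightarrow> \<sigma>' \<subseteq> \<sigma> \<Longrightarrow> \<sigma>' \<noteq> {} \<Longrightarrow> \<sigma>' \<in> K"
    and simplicial: "\<sigma> \<in> K \<Longrightarrow> f ` \<sigma> \<in> L"
    and inj_on_simplex: "\<sigma> \<in> K \<Longrightarrow> inj_on f \<sigma>"
    and vertex_surj: "\<Union>L \<subseteq> f ` \<Union>K"
    and simplex_lift: "p \<in> \<Union>K \<Longrightarrow> \<tau> \<in> L \<Longrightarrow> f p \<in> \<tau> \<Longrightarrow> \<exists>!\<sigma>. \<sigma> \<in> K \<and> p \<in> \<sigma> \<and> f ` \<sigma> = \<tau>"
begin

definition star :: "'p \<Rightarrow> ('p \<Rightarrow> real) set" where
  "star p = {t \<in> topspace (realization K). t p \<noteq> 0}"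

text \<open>The part of \<sigma> lying over the image of \<sigma>' is a face of \<sigma> that
  contains p and has the same image as \<sigma>'. Uniqueness of lifts through p identifies the
  two.\<close>

lemma simplex_lift_mono:
  assumes "\<sigma> \<in> K" "\<sigma>' \<in> K" "p \<in> \<sigma>" "p \<in> \<sigma>'" "f ` \<sigma>' \<subseteq> f ` \<sigma>"
  shows "\<sigma>' \<subseteq> \<sigma>"
proof -
  define \<sigma>1 where "\<sigma>1 = {x \<in> \<sigma>. f x \<in> f ` \<sigma>'}"
  have "\<sigma>1 \<in> K" "p \<in> \<sigma>1"
    using assms face_closed[of \<sigma> \<sigma>1] by (auto simp: \<sigma>1_def)
  moreover have "f ` \<sigma>1 = f ` \<sigma>'"
  proof
    show "f ` \<sigma>' \<subseteq> f ` \<sigma>1"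
    proof
      fix y assume y: "y \<in> f ` \<sigma>'"
      then obtain x where "x \<in> \<sigma>" "f x = y"
        using subsetD[OF assms(5) y] by auto
      then show "y \<in> f ` \<sigma>1"
        using y by (auto simp: \<sigma>1_def)
    qed
  qed (auto simp: \<sigma>1_def)
  moreover have "\<exists>!\<tau>. \<tau> \<in> K \<and> p \<in> \<tau> \<and> f ` \<tau> = f ` \<sigma>'"
    using assms by (intro simplex_lift simplicial) auto
  ultimately have "\<sigma>' = \<sigma>1"
    using assms(2,4) by blast
  then show ?thesis
    by (auto simp: \<sigma>1_def)
qed

section \<open>Carrier simplices of points and continuity of the affine map\<close>

lemma support_simplex:
  assumes "t \<in> topspace (realization K)"
  shows "{p. t p \<noteq> 0} \<in> K \<and> t \<in> closed_simplex {p. t p \<noteq> 0}"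
proof -
  obtain \<sigma> where \<sigma>: "\<sigma> \<in> K" "t \<in> closed_simplex \<sigma>"
    using assms by (auto simp: topspace_realization)
  have sub: "{p. t p \<noteq> 0} \<subseteq> \<sigma>"
    using \<sigma>(2) by (auto simp: closed_simplex_def)
  then have "finite {p. t p \<noteq> 0}"
    using finite_simplex[OF \<sigma>(1)] finite_subset by blast
  then have one: "sum t {p. t p \<noteq> 0} = 1"
    using sum_closed_simplex_superset[OF \<sigma>(2)] finite_simplex[OF \<sigma>(1)] by blast
  then have "{p. t p \<noteq> 0} \<noteq> {}"
    by (metis sum.empty zero_neq_one)
  then show ?thesis
    using \<sigma> sub one face_closed[OF \<sigma>(1) sub] by (auto simp: closed_simplex_def)
qed

lemma closed_simplex_supportI:
  assumes "t \<in> topspace (realization K)" "{p. t p \<noteq> 0} \<subseteq> \<sigma>" "\<sigma> \<in> K"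
  shows "t \<in> closed_simplex \<sigma>"
proof -
  have "t \<in> closed_simplex {p. t p \<noteq> 0}" "finite {p. t p \<noteq> 0}"
    using support_simplex[OF assms(1)] finite_simplex by auto
  moreover from this have "sum t \<sigma> = 1"
    using assms finite_simplex by (intro sum_closed_simplex_superset) auto
  ultimately show ?thesis
    using assms(2) by (auto simp: closed_simplex_def)
qed

text \<open>No coordinates merge, because f is injective on the support. Carriers therefore map onto
  carriers.\<close>

lemma realization_map_support:
  assumes "t \<in> topspace (realization K)"
  shows "{q. realization_map f t q \<noteq> 0} = f ` {p. t p \<noteq> 0}"
proof -
  let ?\<sigma> = "{p. t p \<noteq> 0}"
  have \<sigma>: "?\<sigma> \<in> K" "t \<in> closed_simplex ?\<sigma>"
    using support_simplex[OF assms] by auto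
  show ?thesis
    using realization_map_vertex[OF inj_on_simplex[OF \<sigma>(1)] \<sigma>(2)]
      realization_map_outside[OF \<sigma>(2), where f = f] by fastforce
qed

lemma realization_map_in_topspace:
  assumes "t \<in> topspace (realization K)"
  shows "realization_map f t \<in> topspace (realization L)"
  using support_simplex[OF assms] realization_map_closed_simplex simplicial inj_on_simplex
  unfolding topspace_realization by blast

lemma continuous_realization_map:
  "continuous_map (realization K) (realization L) (realization_map f)"
  unfolding continuous_map
proof (intro conjI allI impI)
  show "realization_map f ` topspace (realization K) \<subseteq> topspace (realization L)"
    using realization_map_in_topspace by blast
  fix U assume U: "openin (realization L) U"
  show "openin (realization K) {t \<in> topspace (realization K). realization_map f t \<in> U}"
    unfolding openin_realization
  proof (intro conjI ballI)
    show "{t \<in> topspace (realization K). realization_map f t \<in> U} \<subseteq> (\<Union>\<sigma>\<in>K. closed_simplex \<sigma>)"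
      by (auto simp: topspace_realization)
    fix \<sigma> assume \<sigma>: "\<sigma> \<in> K"
    \<comment> \<open>Points of \<sigma> land in the image simplex, so on \<sigma> only the trace of
      U on that simplex matters, and this trace is open by the weak topology of L.\<close>
    have "{t \<in> topspace (realization K). realization_map f t \<in> U} \<inter> closed_simplex \<sigma> =
        closed_simplex \<sigma> \<inter> realization_map f -` (U \<inter> closed_simplex (f ` \<sigma>))"
      using \<sigma> realization_map_closed_simplex[OF inj_on_simplex[OF \<sigma>]]
      by (auto simp: topspace_realization)
    moreover have "openin (top_of_set (closed_simplex \<sigma>)) \<dots>"
      using \<sigma> U realization_map_closed_simplex[OF inj_on_simplex[OF \<sigma>]] simplicial[OF \<sigma>]
      by (intro continuous_openin_preimage[OF continuous_on_realization_map,
            where T = "closed_simplex (f ` \<sigma>)"]) (auto simp: inj_on_simplex openin_realization)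
    ultimately show "openin (top_of_set (closed_simplex \<sigma>))
        ({t \<in> topspace (realization K). realization_map f t \<in> U} \<inter> closed_simplex \<sigma>)"
      by simp
  qed
qed

lemma lift_point:
  assumes "\<sigma> \<in> K" "t \<in> closed_simplex (f ` \<sigma>)"
  shows "\<exists>s \<in> closed_simplex \<sigma>. realization_map f s = t"
proof -
  define s where "s p = (if p \<in> \<sigma> then t (f p) else 0)" for p
  have inj: "inj_on f \<sigma>"
    by (rule inj_on_simplex[OF assms(1)])
  have s: "s \<in> closed_simplex \<sigma>"
    using assms(2) by (auto simp: closed_simplex_def s_def sum.reindex[OF inj])
  moreover have "realization_map f s q = t q" for q
    using realization_map_vertex[OF inj s] realization_map_outside[OF s, of q f] assms(2)
    by (cases "q \<in> f ` \<sigma>") (auto simp: s_def closed_simplex_def)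
  ultimately show ?thesis
    by blast
qed

section \<open>Open stars and their images\<close>

lemma openin_star:
  assumes "p \<in> \<Union>K"
  shows "openin (realization K) (star p)"
  unfolding openin_realization
proof (intro conjI ballI)
  show "star p \<subseteq> (\<Union>\<sigma>\<in>K. closed_simplex \<sigma>)"
    by (auto simp: star_def topspace_realization)
  fix \<sigma> assume "\<sigma> \<in> K"
  then have "star p \<inter> closed_simplex \<sigma> = closed_simplex \<sigma> \<inter> (\<lambda>t. t p) -` (- {0})"
    by (auto simp: star_def topspace_realization)
  moreover have "openin (top_of_set (closed_simplex \<sigma>)) \<dots>"
    by (intro continuous_openin_preimage_gen
        continuous_on_subset[OF continuous_on_product_coordinates]) auto
  ultimately show "openin (top_of_set (closed_simplex \<sigma>)) (star p \<inter> closed_simplex \<sigma>)"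
    by simp
qed

text \<open>Points with equal images have supports with equal images. Both supports contain p, so
  they coincide by uniqueness of lifts, and on a single simplex the coordinates can be read off from
  the image.\<close>

lemma inj_on_star:
  assumes "p \<in> \<Union>K"
  shows "inj_on (realization_map f) (star p)"
proof (rule inj_onI)
  fix s t assume st: "s \<in> star p" "t \<in> star p" "realization_map f s = realization_map f t"
  let ?\<sigma> = "{x. s x \<noteq> 0}"
  have top: "s \<in> topspace (realization K)" "t \<in> topspace (realization K)" "s p \<noteq> 0" "t p \<noteq> 0"
    using st by (auto simp: star_def)
  have "f ` ?\<sigma> = f ` {x. t x \<noteq> 0}"
    using realization_map_support[OF top(1)] realization_map_support[OF top(2)] st(3) by simp
  then have eq: "{x. t x \<noteq> 0} = ?\<sigma>"
    using simplex_lift_mono[of ?\<sigma> "{x. t x \<noteq> 0}" p] simplex_lift_mono[of "{x. t x \<noteq> 0}" ?\<sigma> p]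
      support_simplex[OF top(1)] support_simplex[OF top(2)] top by auto
  have inj: "inj_on f ?\<sigma>"
    using support_simplex[OF top(1)] inj_on_simplex by blast
  have "s x = t x" for x
  proof (cases "x \<in> ?\<sigma>")
    case True
    then show ?thesis
      using realization_map_vertex[OF inj, of s x] realization_map_vertex[OF inj, of t x]
        support_simplex[OF top(1)] support_simplex[OF top(2)] st(3) eq by metis
  next
    case False
    then show ?thesis
      using eq by auto
  qed
  then show "s = t" ..
qed

text \<open>On a base simplex \<tau> without the vertex \<open>f p\<close> the image is empty.
  Otherwise \<tau> has a single lift \<sigma> through p, and the trace of the image on \<tau> is the
  preimage of V under the inverse of the map from \<sigma> to \<tau>.\<close>

lemma open_image_star:
  assumes p: "p \<in> \<Union>K" and V: "openin (realization K) V" "V \<subseteq> star p"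
  shows "openin (realization L) (realization_map f ` V)"
  unfolding openin_realization
proof (intro conjI ballI)
  show "realization_map f ` V \<subseteq> (\<Union>\<tau>\<in>L. closed_simplex \<tau>)"
    using V(2) realization_map_in_topspace by (auto simp: star_def topspace_realization)
  fix \<tau> assume \<tau>: "\<tau> \<in> L"
  show "openin (top_of_set (closed_simplex \<tau>)) (realization_map f ` V \<inter> closed_simplex \<tau>)"
  proof (cases "f p \<in> \<tau>")
    case False
    have "realization_map f ` V \<inter> closed_simplex \<tau> = {}"
    proof (rule ccontr)
      assume "realization_map f ` V \<inter> closed_simplex \<tau> \<noteq> {}"
      then obtain t where t: "t \<in> V" "realization_map f t \<in> closed_simplex \<tau>"
        by blast
      have "f p \<in> {q. realization_map f t q \<noteq> 0}"
        using t V(2) realization_map_support[of t] by (auto simp: star_def)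
      then show False
        using t(2) False by (auto simp: closed_simplex_def)
    qed
    then show ?thesis
      by simp
  next
    case True
    obtain \<sigma> where \<sigma>: "\<sigma> \<in> K" "p \<in> \<sigma>" "f ` \<sigma> = \<tau>"
      using simplex_lift[OF p \<tau> True] by blast
    have inj: "inj_on f \<sigma>"
      by (rule inj_on_simplex[OF \<sigma>(1)])
    \<comment> \<open>The inverse of the affine bijection from \<sigma> to \<tau>: pull coordinates
      back along f and put zero off \<sigma>.\<close>
    define g where "g t = (\<lambda>x. case (if x \<in> \<sigma> then Some (f x) else None) of
        Some q \<Rightarrow> t q | None \<Rightarrow> (0 :: real))" for t
    have g_cont: "continuous_on (closed_simplex \<tau>) g"
      unfolding g_def by (rule continuous_on_coordinate_map)
    have g_left: "g (realization_map f s) = s" if "s \<in> closed_simplex \<sigma>" for s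
      using that realization_map_vertex[OF inj that] by (auto simp: g_def closed_simplex_def)
    have g_in: "g t \<in> closed_simplex \<sigma> \<and> realization_map f (g t) = t"
      if "t \<in> closed_simplex \<tau>" for t
      using lift_point[OF \<sigma>(1)] that \<sigma>(3) g_left by metis
    \<comment> \<open>Other simplices over \<tau> do not contribute: the support of s contains p and
      maps into \<tau>, so it is a face of the one lift \<sigma>.\<close>
    have V_simplex: "s \<in> closed_simplex \<sigma>"
      if "s \<in> V" "realization_map f s \<in> closed_simplex \<tau>" for s
    proof -
      have s: "s \<in> topspace (realization K)" "s p \<noteq> 0"
        using that V(2) by (auto simp: star_def)
      have "{q. realization_map f s q \<noteq> 0} \<subseteq> \<tau>"
        using that(2) by (auto simp: closed_simplex_def)
      then have "f ` {x. s x \<noteq> 0} \<subseteq> f ` \<sigma>"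
        using realization_map_support[OF s(1)] \<sigma>(3) by simp
      then have "{x. s x \<noteq> 0} \<subseteq> \<sigma>"
        using support_simplex[OF s(1)] s(2) \<sigma> by (intro simplex_lift_mono[of _ _ p]) auto
      then show ?thesis
        using closed_simplex_supportI s(1) \<sigma>(1) by blast
    qed
    have "realization_map f ` V \<inter> closed_simplex \<tau> =
        closed_simplex \<tau> \<inter> g -` (V \<inter> closed_simplex \<sigma>)"
    proof (intro equalityI subsetI)
      fix t assume "t \<in> realization_map f ` V \<inter> closed_simplex \<tau>"
      then show "t \<in> closed_simplex \<tau> \<inter> g -` (V \<inter> closed_simplex \<sigma>)"
        using V_simplex g_left by auto
    next
      fix t assume "t \<in> closed_simplex \<tau> \<inter> g -` (V \<inter> closed_simplex \<sigma>)"
      then show "t \<in> realization_map f ` V \<inter> closed_simplex \<tau>"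
        using g_in by (metis IntD1 IntD2 IntI image_eqI vimageD)
    qed
    moreover have "openin (top_of_set (closed_simplex \<tau>)) \<dots>"
      using V(1) \<sigma>(1) g_in
      by (intro continuous_openin_preimage[OF g_cont, where T = "closed_simplex \<sigma>"]) (auto simp: openin_realization)
    ultimately show ?thesis
      by simp
  qed
qed

text \<open>Around y the evenly covered set is the open star of some vertex \<open>f p0\<close> in
  the support of y. Its sheets are the open stars of the vertices in the fibre over
  \<open>f p0\<close>.\<close>

lemma covering_map_realization:
  "covering_map (realization K) (realization L) (realization_map f)"
proof -
  let ?X = "realization K" and ?Y = "realization L" and ?\<phi> = "realization_map f"
  have star_surj: "t \<in> ?\<phi> ` star p" if p: "p \<in> \<Union>K" and t: "t \<in> topspace ?Y" "t (f p) \<noteq> 0" for p t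
  proof -
    obtain \<tau> where \<tau>: "\<tau> \<in> L" "t \<in> closed_simplex \<tau>"
      using t(1) by (auto simp: topspace_realization)
    then have "f p \<in> \<tau>"
      using t(2) by (auto simp: closed_simplex_def)
    then obtain \<sigma> where \<sigma>: "\<sigma> \<in> K" "p \<in> \<sigma>" "f ` \<sigma> = \<tau>"
      using simplex_lift[OF p \<tau>(1)] by blast
    obtain s where s: "s \<in> closed_simplex \<sigma>" "?\<phi> s = t"
      using lift_point[OF \<sigma>(1)] \<sigma>(3) \<tau>(2) by blast
    have "s p \<noteq> 0"
      using realization_map_vertex[OF inj_on_simplex[OF \<sigma>(1)] s(1) \<sigma>(2)] s(2) t(2) by simp
    then show ?thesis
      using s \<sigma>(1) by (auto simp: star_def topspace_realization)
  qed
  have star_image: "?\<phi> ` star p = {t \<in> topspace ?Y. t (f p) \<noteq> 0}" if "p \<in> \<Union>K" for p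
  proof
    have "?\<phi> t (f p) \<noteq> 0" if "t \<in> star p" for t
      using that realization_map_support[of t] by (auto simp: star_def)
    then show "?\<phi> ` star p \<subseteq> {t \<in> topspace ?Y. t (f p) \<noteq> 0}"
      using realization_map_in_topspace by (auto simp: star_def)
  qed (use star_surj that in blast)
  have nonzero: "\<exists>p\<in>\<Union>K. t (f p) \<noteq> 0" if t: "t \<in> topspace ?Y" for t
  proof -
    obtain \<tau> where \<tau>: "\<tau> \<in> L" "t \<in> closed_simplex \<tau>"
      using t by (auto simp: topspace_realization)
    then have "sum t \<tau> \<noteq> 0"
      by (simp add: closed_simplex_def)
    then obtain q where "q \<in> \<tau>" "t q \<noteq> 0"
      by (meson sum.neutral)
    then show ?thesis
      using vertex_surj \<tau>(1) by blast
  qed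
  have "?\<phi> ` topspace ?X = topspace ?Y"
  proof
    show "topspace ?Y \<subseteq> ?\<phi> ` topspace ?X"
    proof
      fix t assume t: "t \<in> topspace ?Y"
      obtain p where p: "p \<in> \<Union>K" "t (f p) \<noteq> 0"
        using nonzero[OF t] by (rule bexE)
      have "t \<in> ?\<phi> ` star p"
        by (rule star_surj[OF p(1) t p(2)])
      then show "t \<in> ?\<phi> ` topspace ?X"
        by (auto simp: star_def)
    qed
  qed (use realization_map_in_topspace in blast)
  moreover have "\<exists>T. y \<in> T \<and> openin ?Y T \<and> (\<exists>\<V>. \<Union>\<V> = topspace ?X \<inter> ?\<phi> -` T \<and>
      (\<forall>U\<in>\<V>. openin ?X U) \<and> pairwise disjnt \<V> \<and>
      (\<forall>U\<in>\<V>. homeomorphic_map (subtopology ?X U) (subtopology ?Y T) ?\<phi>))"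
    if y: "y \<in> topspace ?Y" for y
  proof -
    obtain p0 where p0: "p0 \<in> \<Union>K" "y (f p0) \<noteq> 0"
      using nonzero[OF y] by (rule bexE)
    define T where "T = {t \<in> topspace ?Y. t (f p0) \<noteq> 0}"
    define \<V> where "\<V> = star ` {p \<in> \<Union>K. f p = f p0}"
    \<comment> \<open>T is the full image of \<open>star p0\<close>, so its openness is an instance
      of the openness of images.\<close>
    have T_open: "openin ?Y T"
      using open_image_star[OF p0(1) openin_star[OF p0(1)] subset_refl] star_image[OF p0(1)]
      by (simp add: T_def)
    have star_T: "?\<phi> ` star p = T" if "p \<in> \<Union>K" "f p = f p0" for p
      using star_image[OF that(1)] that(2) by (simp add: T_def)
    have "\<Union>\<V> = topspace ?X \<inter> ?\<phi> -` T"
    proof (intro equalityI subsetI)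
      fix t assume "t \<in> \<Union>\<V>"
      then show "t \<in> topspace ?X \<inter> ?\<phi> -` T"
        using star_T by (auto simp: \<V>_def star_def)
    next
      fix t assume t: "t \<in> topspace ?X \<inter> ?\<phi> -` T"
      then have "f p0 \<in> f ` {p. t p \<noteq> 0}"
        using realization_map_support[of t] by (auto simp: T_def)
      then obtain p where "t p \<noteq> 0" "f p = f p0"
        by auto
      moreover from this have "p \<in> \<Union>K"
        using support_simplex[of t] t by blast
      ultimately show "t \<in> \<Union>\<V>"
        using t by (auto simp: \<V>_def star_def)
    qed
    moreover have "\<forall>U\<in>\<V>. openin ?X U"
      using openin_star by (auto simp: \<V>_def)
    moreover have "pairwise disjnt \<V>"
    proof (rule pairwiseI)
      fix U U' assume "U \<in> \<V>" "U' \<in> \<V>" "U \<noteq> U'"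
      then obtain p p' where p: "U = star p" "U' = star p'" "f p = f p0" "f p' = f p0" "p \<noteq> p'"
        unfolding \<V>_def by fastforce
      show "disjnt U U'"
      proof (rule ccontr)
        assume "\<not> disjnt U U'"
        then obtain t where t: "t \<in> star p" "t \<in> star p'"
          using p by (auto simp: disjnt_def)
        \<comment> \<open>A common point of two sheets would have both p and p' in its support, a
          simplex on which f cannot identify them.\<close>
        then have "inj_on f {x. t x \<noteq> 0}"
          using support_simplex[of t] inj_on_simplex by (auto simp: star_def)
        then show False
          using t p(3-5) by (auto simp: star_def inj_on_def)
      qed
    qed
    moreover have "\<forall>U\<in>\<V>. homeomorphic_map (subtopology ?X U) (subtopology ?Y T) ?\<phi>"
    proof
      fix U assume "U \<in> \<V>"
      then obtain p where p: "U = star p" "p \<in> \<Union>K" "f p = f p0"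
        by (auto simp: \<V>_def)
      have tops: "topspace (subtopology ?X U) = U" "topspace (subtopology ?Y T) = T"
        by (auto simp: p(1) star_def T_def)
      show "homeomorphic_map (subtopology ?X U) (subtopology ?Y T) ?\<phi>"
      proof (rule bijective_open_imp_homeomorphic_map)
        show "continuous_map (subtopology ?X U) (subtopology ?Y T) ?\<phi>"
          using continuous_realization_map star_T[OF p(2,3)] p(1)
          by (auto simp: continuous_map_in_subtopology continuous_map_from_subtopology tops)
        show "open_map (subtopology ?X U) (subtopology ?Y T) ?\<phi>"
          unfolding open_map_def
        proof (intro allI impI)
          fix V assume "openin (subtopology ?X U) V"
          then have "openin ?X V" "V \<subseteq> star p"
            using openin_star[OF p(2)] p(1) by (auto simp: openin_open_subtopology)
          then show "openin (subtopology ?Y T) (?\<phi> ` V)"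
            using open_image_star[OF p(2)] T_open star_T[OF p(2,3)]
            by (auto simp: openin_open_subtopology)
        qed
      qed (use tops star_T[OF p(2,3)] inj_on_star[OF p(2)] p(1) in auto)
    qed
    ultimately show ?thesis
      using y p0(2) T_open by (intro exI[of _ T] conjI exI[of _ \<V>]) (auto simp: T_def)
  qed
  ultimately show ?thesis
    unfolding covering_map_def using continuous_realization_map by blast
qed

end

text \<open>Given a chain \<tau> through \<open>f p\<close>, every element of \<tau> lifts uniquely
  to one below or above p. The real work is to see that these separately lifted elements are
  comparable with each other.\<close>

lemma simplicial_covering_order_complex:
  assumes refl: "\<And>x. x \<in> P \<Longrightarrow> (x, x) \<in> r"
    and trans: "\<And>x y z. (x, y) \<in> r \<Longrightarrow> (y, z) \<in> r \<Longrightarrow> (x, z) \<in> r"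
    and image: "f ` P = Q"
    and mono: "\<And>x y. (x, y) \<in> r \<Longrightarrow> (f x, f y) \<in> s"
    and field: "r \<subseteq> P \<times> P" "s \<subseteq> Q \<times> Q"
    and lift_below: "\<And>x y. x \<in> P \<Longrightarrow> (y, f x) \<in> s \<Longrightarrow> \<exists>!z. (z, x) \<in> r \<and> f z = y"
    and lift_above: "\<And>x y. x \<in> P \<Longrightarrow> (f x, y) \<in> s \<Longrightarrow> \<exists>!z. (x, z) \<in> r \<and> f z = y"
  shows "simplicial_covering (order_complex P r) (order_complex Q s) f"
proof
  \<comment> \<open>Both x and y are lifts of \<open>f y\<close> below y.\<close>
  have inj: "x = y" if xy: "(x, y) \<in> r" "f x = f y" for x y
  proof -
    have y: "y \<in> P"
      using xy(1) field(1) by auto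
    show ?thesis
      using lift_below[OF y mono[OF xy(1)]] xy refl[OF y] by metis
  qed
  show "inj_on f \<sigma>" if "\<sigma> \<in> order_complex P r" for \<sigma>
  proof (rule inj_onI)
    fix x y assume "x \<in> \<sigma>" "y \<in> \<sigma>" "f x = f y"
    moreover have "(x, y) \<in> r \<or> (y, x) \<in> r"
      using that calculation by (auto simp: order_complex_def Chains_def)
    ultimately show "x = y"
      using inj[of x y] inj[of y x] by auto
  qed
  show "f ` \<sigma> \<in> order_complex Q s" if \<sigma>: "\<sigma> \<in> order_complex P r" for \<sigma>
  proof -
    have "(f x, f y) \<in> s \<or> (f y, f x) \<in> s" if "x \<in> \<sigma>" "y \<in> \<sigma>" for x y
    proof -
      have "(x, y) \<in> r \<or> (y, x) \<in> r"
        using \<sigma> that by (auto simp: order_complex_def Chains_def)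
      then show ?thesis
        using mono by metis
    qed
    then show ?thesis
      using \<sigma> image by (auto simp: order_complex_def Chains_def)
  qed
  have "{x} \<in> order_complex P r" if "x \<in> P" for x
    using that refl by (auto simp: order_complex_def Chains_def)
  then have vertices: "\<Union>(order_complex P r) = P"
    by (auto simp: order_complex_def)
  then show "\<Union>(order_complex Q s) \<subseteq> f ` \<Union>(order_complex P r)"
    using image by (auto simp: order_complex_def)
  fix p \<tau> assume "p \<in> \<Union>(order_complex P r)" and \<tau>: "\<tau> \<in> order_complex Q s" "f p \<in> \<tau>"
  then have p: "p \<in> P"
    using vertices by blast
  \<comment> \<open>A chain through p consists of elements comparable with p, so any lift of \<tau>
    through p lies in this set.\<close>
  define \<sigma> where "\<sigma> = {x. f x \<in> \<tau> \<and> ((x, p) \<in> r \<or> (p, x) \<in> r)}"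
  have uniq: "x = y" if xy: "x \<in> \<sigma>" "y \<in> \<sigma>" "f x = f y" for x y
  proof -
    \<comment> \<open>Elements on opposite sides of p are comparable by transitivity; what remains
      is two elements on the same side.\<close>
    consider "(x, y) \<in> r" | "(y, x) \<in> r" | "(x, p) \<in> r \<and> (y, p) \<in> r" | "(p, x) \<in> r \<and> (p, y) \<in> r"
      using xy trans[of x p y] trans[of y p x] by (auto simp: \<sigma>_def)
    then show ?thesis
    proof cases
      case 3
      then show ?thesis
        using lift_below[OF p, of "f x"] that(3) mono[of x p] by metis
    next
      case 4
      then show ?thesis
        using lift_above[OF p, of "f x"] that(3) mono[of p x] by metis
    qed (use inj that in metis)+
  qed
  have sub: "\<sigma> \<subseteq> P"
    using field by (auto simp: \<sigma>_def)
  have img: "f ` \<sigma> = \<tau>"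
  proof
    show "\<tau> \<subseteq> f ` \<sigma>"
    proof
      fix y assume y: "y \<in> \<tau>"
      then have "(y, f p) \<in> s \<or> (f p, y) \<in> s"
        using \<tau> by (auto simp: order_complex_def Chains_def)
      then obtain z where "(z, p) \<in> r \<or> (p, z) \<in> r" "f z = y"
        using lift_below[OF p] lift_above[OF p] by metis
      then show "y \<in> f ` \<sigma>"
        using y by (auto simp: \<sigma>_def)
    qed
  qed (auto simp: \<sigma>_def)
  have fin: "finite \<sigma>"
    using img uniq \<tau>(1) by (metis (no_types, lifting) finite_imageD inj_onI order_complex_def mem_Collect_eq)
  have chain: "(x, y) \<in> r \<or> (y, x) \<in> r" if "x \<in> \<sigma>" "y \<in> \<sigma>" for x y
  proof -
    have half: "(x, y) \<in> r \<or> (y, x) \<in> r"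
      if xy: "x \<in> \<sigma>" "y \<in> \<sigma>" "(f x, f y) \<in> s" for x y
    proof -
      consider "(x, y) \<in> r" | "(y, x) \<in> r" | "(x, p) \<in> r" "(y, p) \<in> r" | "(p, x) \<in> r" "(p, y) \<in> r"
        using xy trans[of x p y] trans[of y p x] by (auto simp: \<sigma>_def)
      then show ?thesis
      proof cases
        case 3
        \<comment> \<open>Lifting the base relation at y gives some z below y, hence below p. Then z
          and x are elements of \<sigma> over the same point, so they are equal. The case above p is
          dual.\<close>
        obtain z where z: "(z, y) \<in> r" "f z = f x"
          using lift_below[OF subsetD[OF sub xy(2)] xy(3)] by metis
        then have "z \<in> \<sigma>"
          using trans[OF z(1) 3(2)] xy(1) by (auto simp: \<sigma>_def)
        then show ?thesis
          using uniq[of z x] z xy(1) by auto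
      next
        case 4
        obtain z where z: "(x, z) \<in> r" "f z = f y"
          using lift_above[OF subsetD[OF sub xy(1)] xy(3)] by metis
        then have "z \<in> \<sigma>"
          using trans[OF 4(1) z(1)] xy(2) by (auto simp: \<sigma>_def)
        then show ?thesis
          using uniq[of z y] z xy(2) by auto
      qed auto
    qed
    have "(f x, f y) \<in> s \<or> (f y, f x) \<in> s"
      using that \<tau>(1) by (auto simp: \<sigma>_def order_complex_def Chains_def)
    then show ?thesis
      using half that by blast
  qed
  have p_in: "p \<in> \<sigma>"
    using refl[OF p] \<tau>(2) by (simp add: \<sigma>_def)
  show "\<exists>!\<sigma>. \<sigma> \<in> order_complex P r \<and> p \<in> \<sigma> \<and> f ` \<sigma> = \<tau>"
  proof (rule ex1I[of _ \<sigma>])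
    show "\<sigma> \<in> order_complex P r \<and> p \<in> \<sigma> \<and> f ` \<sigma> = \<tau>"
      using sub fin chain p_in img by (auto simp: order_complex_def Chains_def)
    fix \<sigma>' assume \<sigma>': "\<sigma>' \<in> order_complex P r \<and> p \<in> \<sigma>' \<and> f ` \<sigma>' = \<tau>"
    then have "\<sigma>' \<subseteq> \<sigma>"
      by (auto simp: order_complex_def Chains_def \<sigma>_def)
    moreover have "\<sigma> \<subseteq> \<sigma>'"
    proof
      fix x assume x: "x \<in> \<sigma>"
      then obtain x' where "x' \<in> \<sigma>'" "f x' = f x"
        using \<sigma>' img by (metis imageE imageI)
      then show "x \<in> \<sigma>'"
        using uniq[OF x, of x'] \<open>\<sigma>' \<subseteq> \<sigma>\<close> by auto
    qed
    ultimately show "\<sigma>' = \<sigma>" ..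
  qed
qed (auto simp: order_complex_def Chains_def finite_subset)

section \<open>Paths and their lifts\<close>

lemma step_source_inverse [simp]: "step_source (step_inverse x) = step_target x"
  by (cases x; cases "fst x") auto

lemma step_target_inverse [simp]: "step_target (step_inverse x) = step_source x"
  by (cases x; cases "fst x") auto

lemma fst_step_inverse [simp]: "fst (step_inverse x) = fst x"
  by (cases x) auto

lemma step_inverse_inverse [simp]: "step_inverse (step_inverse x) = x"
  by (cases x) auto

lemma is_walk_begin: "is_walk G v xs \<Longrightarrow> v \<in> pverts G"
  by (cases xs) auto

lemma walk_end_append [simp]: "walk_end v (xs @ ys) = walk_end (walk_end v xs) ys"
  by (induction xs arbitrary: v) auto

lemma is_walk_append: "is_walk G v (xs @ ys) \<longleftrightarrow> is_walk G v xs \<and> is_walk G (walk_end v xs) ys"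
  by (induction xs arbitrary: v) (auto dest: is_walk_begin)

lemma walk_end_in_verts: "is_walk G v xs \<Longrightarrow> walk_end v xs \<in> pverts G"
  by (induction xs arbitrary: v) auto

lemma walk_end_rev:
  "is_walk G v xs \<Longrightarrow> walk_end (walk_end v xs) (rev (map step_inverse xs)) = v"
  by (induction xs arbitrary: v) auto

lemma is_walk_rev:
  "is_walk G v xs \<Longrightarrow> is_walk G (walk_end v xs) (rev (map step_inverse xs))"
  by (induction xs arbitrary: v) (auto simp: is_walk_append walk_end_rev intro: is_walk_begin)

lemma path_begin_in_verts: "\<alpha> \<in> opaths G \<Longrightarrow> path_begin \<alpha> \<in> pverts G"
  by (simp add: opaths_def path_begin_def is_walk_begin)

lemma path_end_in_verts: "\<alpha> \<in> opaths G \<Longrightarrow> path_end \<alpha> \<in> pverts G"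
  by (simp add: opaths_def path_end_def walk_end_in_verts)

lemma path_inverse_in_opaths: "\<alpha> \<in> opaths G \<Longrightarrow> path_inverse \<alpha> \<in> opaths G"
  by (simp add: opaths_def path_inverse_def path_end_def is_walk_rev)

lemma path_begin_inverse: "path_begin (path_inverse \<alpha>) = path_end \<alpha>"
  by (simp add: path_begin_def path_inverse_def)

lemma path_end_inverse: "\<alpha> \<in> opaths G \<Longrightarrow> path_end (path_inverse \<alpha>) = path_begin \<alpha>"
  by (simp add: opaths_def path_begin_def path_end_def path_inverse_def walk_end_rev)

lemma path_inverse_inverse: "\<alpha> \<in> opaths G \<Longrightarrow> path_inverse (path_inverse \<alpha>) = \<alpha>"
  by (cases \<alpha>) (simp add: path_inverse_def path_end_def opaths_def walk_end_rev rev_map[symmetric] comp_def)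

lemma path_concat_in_opaths:
  "\<alpha> \<in> opaths G \<Longrightarrow> \<beta> \<in> opaths G \<Longrightarrow> path_end \<alpha> = path_begin \<beta> \<Longrightarrow> \<alpha> \<cdot>\<cdot> \<beta> \<in> opaths G"
  by (simp add: opaths_def path_concat_def path_begin_def path_end_def is_walk_append)

lemma path_begin_concat: "path_begin (\<alpha> \<cdot>\<cdot> \<beta>) = path_begin \<alpha>"
  by (simp add: path_begin_def path_concat_def)

lemma path_end_concat: "path_end \<alpha> = path_begin \<beta> \<Longrightarrow> path_end (\<alpha> \<cdot>\<cdot> \<beta>) = path_end \<beta>"
  by (simp add: path_begin_def path_end_def path_concat_def)

lemma path_length_concat: "path_length (\<alpha> \<cdot>\<cdot> \<beta>) = path_length \<alpha> + path_length \<beta>"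
  by (simp add: path_length_def path_concat_def)

lemma positive_path_concat: "positive_path (\<alpha> \<cdot>\<cdot> \<beta>) \<longleftrightarrow> positive_path \<alpha> \<and> positive_path \<beta>"
  by (auto simp: positive_path_def path_concat_def)

lemma step_target_map: "step_target (map_prod (map_prod f f) id x) = f (step_target x)"
  by (cases x; cases "fst x") auto

lemma walk_end_map: "walk_end (f v) (map (map_prod (map_prod f f) id) xs) = f (walk_end v xs)"
  by (induction xs arbitrary: v) (auto simp: step_target_map simp del: step_target.simps)

lemma path_begin_map: "path_begin (map_path f \<alpha>) = f (path_begin \<alpha>)"
  by (simp add: path_begin_def map_path_def)

lemma path_end_map: "path_end (map_path f \<alpha>) = f (path_end \<alpha>)"
  by (simp add: path_end_def map_path_def walk_end_map)

lemma map_path_concat: "map_path f (\<alpha> \<cdot>\<cdot> \<beta>) = map_path f \<alpha> \<cdot>\<cdot> map_path f \<beta>"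
  by (simp add: map_path_def path_concat_def)

lemma map_path_inverse: "map_path f (path_inverse \<alpha>) = path_inverse (map_path f \<alpha>)"
proof -
  have "map_prod (map_prod f f) id (step_inverse x) = step_inverse (map_prod (map_prod f f) id x)" for x
    by (cases x) auto
  then show ?thesis
    by (simp add: map_path_def path_inverse_def path_end_map[unfolded map_path_def] rev_map)
qed

lemma map_path_id: "map_path id \<alpha> = \<alpha>"
  by (simp add: map_path_def prod.map_id0)

section \<open>Lifts in a cover of oriented systems\<close>

locale path_lifting =
  fixes \<Theta> :: "'v pair_pre_digraph" and R :: "'v opath rel"
    and \<Gamma> :: "'w pair_pre_digraph" and S :: "'w opath rel" and \<rho> :: "'v \<Rightarrow> 'w"
  assumes cover: "oriented_cover \<Theta> R \<Gamma> S \<rho>"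
    and congruence: "path_congruence \<Theta> R"
begin

lemma path_lift:
  assumes "v \<in> pverts \<Theta>" "\<alpha> \<in> opaths \<Gamma>" "path_begin \<alpha> = \<rho> v"
  shows "path_lift \<Theta> \<rho> v \<alpha> \<in> opaths \<Theta>" "path_begin (path_lift \<Theta> \<rho> v \<alpha>) = v"
    "map_path \<rho> (path_lift \<Theta> \<rho> v \<alpha>) = \<alpha>"
proof -
  have "\<exists>!\<beta>. \<beta> \<in> opaths \<Theta> \<and> path_begin \<beta> = v \<and> map_path \<rho> \<beta> = \<alpha>"
    using cover assms by (simp add: oriented_cover_def)
  from theI'[OF this] show "path_lift \<Theta> \<rho> v \<alpha> \<in> opaths \<Theta>" "path_begin (path_lift \<Theta> \<rho> v \<alpha>) = v"
    "map_path \<rho> (path_lift \<Theta> \<rho> v \<alpha>) = \<alpha>"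
    unfolding path_lift_def by auto
qed

lemma path_lift_unique:
  assumes "\<beta> \<in> opaths \<Theta>" "path_begin \<beta> = v" "map_path \<rho> \<beta> = \<alpha>" "\<alpha> \<in> opaths \<Gamma>"
  shows "path_lift \<Theta> \<rho> v \<alpha> = \<beta>"
proof -
  have "v \<in> pverts \<Theta>" "path_begin \<alpha> = \<rho> v"
    using assms path_begin_in_verts path_begin_map by blast+
  then have "\<exists>!\<beta>. \<beta> \<in> opaths \<Theta> \<and> path_begin \<beta> = v \<and> map_path \<rho> \<beta> = \<alpha>"
    using cover assms(4) by (simp add: oriented_cover_def)
  then show ?thesis
    unfolding path_lift_def using assms by (intro the1_equality) auto
qed

lemma path_lift_end:
  assumes "v \<in> pverts \<Theta>" "\<alpha> \<in> opaths \<Gamma>" "path_begin \<alpha> = \<rho> v"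
  shows "path_end (path_lift \<Theta> \<rho> v \<alpha>) \<in> pverts \<Theta>"
    "\<rho> (path_end (path_lift \<Theta> \<rho> v \<alpha>)) = path_end \<alpha>"
  using path_lift[OF assms] path_end_in_verts[of "path_lift \<Theta> \<rho> v \<alpha>"]
    path_end_map[of \<rho> "path_lift \<Theta> \<rho> v \<alpha>"] by simp_all

text \<open>Lifts of equivalent paths are equivalent upstairs, and a path congruence relates only
  paths with equal ends.\<close>

lemma path_lift_end_cong:
  assumes "v \<in> pverts \<Theta>" "(\<alpha>, \<beta>) \<in> S" "path_begin \<alpha> = \<rho> v" "path_begin \<beta> = \<rho> v"
  shows "path_end (path_lift \<Theta> \<rho> v \<alpha>) = path_end (path_lift \<Theta> \<rho> v \<beta>)"
proof -
  have "(path_lift \<Theta> \<rho> v \<alpha>, path_lift \<Theta> \<rho> v \<beta>) \<in> R"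
    using cover assms unfolding oriented_cover_def by blast
  then show ?thesis
    using congruence unfolding path_congruence_def by blast
qed

text \<open>The lift of \<alpha> followed by the lift of \<beta> at its end is a lift of the
  concatenation, hence the only one.\<close>

lemma path_lift_end_concat:
  assumes "v \<in> pverts \<Theta>" "\<alpha> \<in> opaths \<Gamma>" "\<beta> \<in> opaths \<Gamma>"
    and "path_begin \<alpha> = \<rho> v" "path_end \<alpha> = path_begin \<beta>"
  shows "path_end (path_lift \<Theta> \<rho> v (\<alpha> \<cdot>\<cdot> \<beta>)) =
    path_end (path_lift \<Theta> \<rho> (path_end (path_lift \<Theta> \<rho> v \<alpha>)) \<beta>)"
proof -
  let ?w = "path_end (path_lift \<Theta> \<rho> v \<alpha>)"
  have w: "?w \<in> pverts \<Theta>" "path_begin \<beta> = \<rho> ?w"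
    using path_lift_end[OF assms(1,2,4)] assms(5) by auto
  have "path_lift \<Theta> \<rho> v (\<alpha> \<cdot>\<cdot> \<beta>) = path_lift \<Theta> \<rho> v \<alpha> \<cdot>\<cdot> path_lift \<Theta> \<rho> ?w \<beta>"
    using path_lift[OF assms(1,2,4)] path_lift[OF w(1) assms(3) w(2)] assms
    by (intro path_lift_unique) (auto simp: path_concat_in_opaths path_begin_concat map_path_concat)
  then show ?thesis
    using path_lift(2)[OF w(1) assms(3) w(2)] by (simp add: path_end_concat)
qed

text \<open>Transport along \<alpha> is a bijection between fibres: lifting the inverse path at v
  undoes it, since the inverse of that lift is a lift of \<alpha> ending at v. This will supply the
  elements above a given element of the limit.\<close>

lemma path_lift_end_bij:
  assumes v: "v \<in> pverts \<Theta>" and \<alpha>: "\<alpha> \<in> opaths \<Gamma>" "path_end \<alpha> = \<rho> v"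
  shows "\<exists>!w. w \<in> pverts \<Theta> \<and> \<rho> w = path_begin \<alpha> \<and> path_end (path_lift \<Theta> \<rho> w \<alpha>) = v"
proof (rule ex1I)
  let ?\<gamma> = "path_lift \<Theta> \<rho> v (path_inverse \<alpha>)"
  have inv: "path_inverse \<alpha> \<in> opaths \<Gamma>" "path_begin (path_inverse \<alpha>) = \<rho> v"
    using \<alpha> by (auto simp: path_inverse_in_opaths path_begin_inverse)
  note \<gamma> = path_lift[OF v inv]
  have "path_lift \<Theta> \<rho> (path_end ?\<gamma>) \<alpha> = path_inverse ?\<gamma>"
    using \<gamma> \<alpha>(1)
    by (intro path_lift_unique)
      (auto simp: path_inverse_in_opaths path_begin_inverse map_path_inverse path_inverse_inverse)
  then show "path_end ?\<gamma> \<in> pverts \<Theta> \<and> \<rho> (path_end ?\<gamma>) = path_begin \<alpha> \<and>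
      path_end (path_lift \<Theta> \<rho> (path_end ?\<gamma>) \<alpha>) = v"
    using path_lift_end[OF v inv] path_end_inverse[OF \<gamma>(1)] path_end_inverse[OF \<alpha>(1)] \<gamma>(2) by simp
  fix w assume w: "w \<in> pverts \<Theta> \<and> \<rho> w = path_begin \<alpha> \<and> path_end (path_lift \<Theta> \<rho> w \<alpha>) = v"
  then have \<beta>: "path_lift \<Theta> \<rho> w \<alpha> \<in> opaths \<Theta>" "path_begin (path_lift \<Theta> \<rho> w \<alpha>) = w"
      "map_path \<rho> (path_lift \<Theta> \<rho> w \<alpha>) = \<alpha>"
    using path_lift[of w \<alpha>] \<alpha>(1) by auto
  then have "?\<gamma> = path_inverse (path_lift \<Theta> \<rho> w \<alpha>)"
    using w inv(1)
    by (intro path_lift_unique) (auto simp: path_inverse_in_opaths path_begin_inverse map_path_inverse)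
  then show "w = path_end ?\<gamma>"
    using path_end_inverse[OF \<beta>(1)] \<beta>(2) by simp
qed

end

section \<open>Sign vectors of points\<close>

text \<open>An affine equation of H, chosen once and for all. Its orientation is immaterial to
  faces, chambers and separation, which only compare signs at two points.\<close>

definition hyperplane_function :: "'a::euclidean_space set \<Rightarrow> 'a \<Rightarrow> real" where
  "hyperplane_function H = (SOME f. \<exists>a b. a \<noteq> 0 \<and> H = {x. a \<bullet> x = b} \<and> f = (\<lambda>x. a \<bullet> x - b))"

abbreviation side :: "'a::euclidean_space set \<Rightarrow> 'a \<Rightarrow> real" where
  "side H x \<equiv> sgn (hyperplane_function H x)"

lemma hyperplane_function:
  assumes "hyperplane H"
  obtains a b where "a \<noteq> 0" "H = {x. a \<bullet> x = b}" "hyperplane_function H = (\<lambda>x. a \<bullet> x - b)"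
proof -
  have "\<exists>f a b. a \<noteq> 0 \<and> H = {x. a \<bullet> x = b} \<and> f = (\<lambda>x. a \<bullet> x - b)"
    using assms by (auto simp: hyperplane_def)
  from someI_ex[OF this] show ?thesis
    using that unfolding hyperplane_function_def by blast
qed

lemma mem_hyperplane_iff:
  assumes "hyperplane H"
  shows "x \<in> H \<longleftrightarrow> hyperplane_function H x = 0"
  using assms by (rule hyperplane_function) auto

lemma hyperplane_function_affine:
  assumes "hyperplane H"
  shows "hyperplane_function H (x + t *\<^sub>R (y - x)) =
    (1 - t) * hyperplane_function H x + t * hyperplane_function H y"
  using assms by (rule hyperplane_function) (simp add: algebra_simps inner_diff_right)

text \<open>Meant for segments: if the start lies on the hyperplane or on the side of the end, every
  later point has the sign of the end.\<close>

lemma sgn_convex_combination: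
  fixes a b t :: real
  assumes "0 < t" "t \<le> 1" "sgn a = 0 \<or> sgn a = sgn b"
  shows "sgn ((1 - t) * a + t * b) = sgn b"
proof (cases b "0 :: real" rule: linorder_cases)
  case less
  then have "(1 - t) * a \<le> 0" "t * b < 0"
    using assms by (auto simp: sgn_if mult_le_0_iff mult_less_0_iff split: if_splits)
  then show ?thesis
    using less by simp
next
  case equal
  then show ?thesis
    using assms by (auto simp: sgn_if split: if_splits)
next
  case greater
  then have "(1 - t) * a \<ge> 0" "t * b > 0"
    using assms by (auto simp: sgn_if split: if_splits)
  then show ?thesis
    using greater by simp
qed

text \<open>Open half-spaces are convex, which joins points with equal signs; a connected set
  reaching from one closed half-space to the other meets the hyperplane by the intermediate value
  theorem.\<close>

lemma same_side_iff:
  assumes "hyperplane H"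
  shows "same_side H x y \<longleftrightarrow> side H x = side H y"
proof -
  obtain a b where H: "H = {x. a \<bullet> x = b}" "hyperplane_function H = (\<lambda>x. a \<bullet> x - b)"
    using assms by (rule hyperplane_function) (rule that)
  have neg: "connected_component (- H) x y" if "a \<bullet> x < b" "a \<bullet> y < b"
    unfolding connected_component_def using that H
    by (intro exI[of _ "{x. a \<bullet> x < b}"]) (auto intro: convex_connected convex_halfspace_lt)
  have pos: "connected_component (- H) x y" if "a \<bullet> x > b" "a \<bullet> y > b"
    unfolding connected_component_def using that H
    by (intro exI[of _ "{x. a \<bullet> x > b}"]) (auto intro: convex_connected convex_halfspace_gt)
  have sep: "\<not> connected_component (- H) x y"
    if xy: "a \<bullet> x \<le> b \<and> b \<le> a \<bullet> y \<or> a \<bullet> y \<le> b \<and> b \<le> a \<bullet> x"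
  proof
    assume "connected_component (- H) x y"
    then obtain T where T: "connected T" "T \<subseteq> - H" "x \<in> T" "y \<in> T"
      by (auto simp: connected_component_def)
    then have "\<exists>z\<in>T. a \<bullet> z = b"
      using xy connected_ivt_hyperplane[of T x y a b] connected_ivt_hyperplane[of T y x a b] by auto
    then show False
      using T(2) H(1) by auto
  qed
  show ?thesis
    unfolding same_side_def H(2)
    using neg pos sep H(1) by (cases "a \<bullet> x" b rule: linorder_cases; cases "a \<bullet> y" b rule: linorder_cases) auto
qed

text \<open>The cell through a base point. Faces and chambers are both handled through such base
  points, with equality of cells becoming equality of signs.\<close>

definition sign_cell :: "'a::euclidean_space set set \<Rightarrow> 'a \<Rightarrow> 'a set" where
  "sign_cell \<A> x = {y. \<forall>H\<in>\<A>. same_side H x y}"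

lemma faces_eq: "faces \<A> = range (sign_cell \<A>)"
  by (simp add: faces_def sign_cell_def[abs_def])

lemma arrangement_hyperplane: "arrangement \<A> \<Longrightarrow> H \<in> \<A> \<Longrightarrow> hyperplane H"
  by (simp add: arrangement_def)

lemma mem_sign_cell:
  "arrangement \<A> \<Longrightarrow> y \<in> sign_cell \<A> x \<longleftrightarrow> (\<forall>H\<in>\<A>. side H y = side H x)"
  by (auto simp: sign_cell_def same_side_iff arrangement_hyperplane)

lemma sign_cell_self: "arrangement \<A> \<Longrightarrow> x \<in> sign_cell \<A> x"
  by (simp add: mem_sign_cell)

lemma sign_cell_eq_iff:
  assumes "arrangement \<A>"
  shows "sign_cell \<A> x = sign_cell \<A> y \<longleftrightarrow> (\<forall>H\<in>\<A>. side H x = side H y)"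
proof
  assume "sign_cell \<A> x = sign_cell \<A> y"
  then have "x \<in> sign_cell \<A> y"
    using sign_cell_self[OF assms] by blast
  then show "\<forall>H\<in>\<A>. side H x = side H y"
    using mem_sign_cell[OF assms] by blast
next
  assume "\<forall>H\<in>\<A>. side H x = side H y"
  then show "sign_cell \<A> x = sign_cell \<A> y"
    using mem_sign_cell[OF assms] by auto
qed

lemma generic_iff:
  assumes "arrangement \<A>"
  shows "x \<notin> \<Union>\<A> \<longleftrightarrow> (\<forall>H\<in>\<A>. side H x \<noteq> 0)"
  using assms by (auto simp: mem_hyperplane_iff arrangement_hyperplane sgn_0_0)

lemma convex_sign_cell:
  assumes "arrangement \<A>"
  shows "convex (sign_cell \<A> x)"
proof -
  have "convex {y. side H y = side H x}" if "hyperplane H" for H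
  proof -
    obtain a b where H: "hyperplane_function H = (\<lambda>x. a \<bullet> x - b)"
      using \<open>hyperplane H\<close> by (rule hyperplane_function) (rule that)
    have "{y. side H y = side H x} = (if a \<bullet> x = b then {y. a \<bullet> y = b}
        else if a \<bullet> x < b then {y. a \<bullet> y < b} else {y. a \<bullet> y > b})"
      by (auto simp: H sgn_if split: if_splits)
    then show ?thesis
      by (simp add: convex_hyperplane convex_halfspace_lt convex_halfspace_gt)
  qed
  moreover have "sign_cell \<A> x = (\<Inter>H\<in>\<A>. {y. side H y = side H x})"
    using mem_sign_cell[OF assms] by auto
  ultimately show ?thesis
    using assms by (auto intro: convex_INT simp: arrangement_hyperplane)
qed

text \<open>A component of the complement crosses no hyperplane of \<A>. Conversely the cell is
  convex and avoids all hyperplanes, so it stays within one component.\<close>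

lemma connected_component_sign_cell:
  assumes "arrangement \<A>" "x \<notin> \<Union>\<A>"
  shows "connected_component_set (- \<Union>\<A>) x = sign_cell \<A> x"
proof
  show "connected_component_set (- \<Union>\<A>) x \<subseteq> sign_cell \<A> x"
  proof
    fix y assume "y \<in> connected_component_set (- \<Union>\<A>) x"
    then have "connected_component (- H) x y" if "H \<in> \<A>" for H
      using that connected_component_of_subset[of "- \<Union>\<A>" x y "- H"] by auto
    then show "y \<in> sign_cell \<A> x"
      by (simp add: sign_cell_def same_side_def)
  qed
  have "y \<notin> \<Union>\<A>" if "y \<in> sign_cell \<A> x" for y
    using that assms(2) unfolding generic_iff[OF assms(1)] mem_sign_cell[OF assms(1)] by simp
  then have "sign_cell \<A> x \<subseteq> - \<Union>\<A>"
    by blast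
  then show "sign_cell \<A> x \<subseteq> connected_component_set (- \<Union>\<A>) x"
    using assms(1) by (intro connected_component_maximal convex_connected convex_sign_cell sign_cell_self)
qed

lemma chambers_iff:
  assumes "arrangement \<A>"
  shows "C \<in> chambers \<A> \<longleftrightarrow> (\<exists>x. x \<notin> \<Union>\<A> \<and> C = sign_cell \<A> x)"
  using connected_component_sign_cell[OF assms]
  by (auto simp: chambers_def components_def)

lemma sign_cell_chamber: "arrangement \<A> \<Longrightarrow> x \<notin> \<Union>\<A> \<Longrightarrow> sign_cell \<A> x \<in> chambers \<A>"
  using chambers_iff by blast

section \<open>Closures of cells and points near a face\<close>

lemma segment_tendsto:
  fixes x y :: "'a::real_normed_vector"
  shows "(\<lambda>n. y + inverse (real (Suc n)) *\<^sub>R (x - y)) \<longlonglongrightarrow> y"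
proof -
  have "(\<lambda>n. y + inverse (real (Suc n)) *\<^sub>R (x - y)) \<longlonglongrightarrow> y + 0 *\<^sub>R (x - y)"
    by (intro tendsto_intros LIMSEQ_inverse_real_of_nat)
  then show ?thesis
    by simp
qed

text \<open>The sign condition on y is closed. Conversely it places the segment from x to y, without
  y, inside the cell of x, and y is a limit of this segment.\<close>

lemma mem_closure_sign_cell:
  assumes "arrangement \<A>"
  shows "y \<in> closure (sign_cell \<A> x) \<longleftrightarrow> (\<forall>H\<in>\<A>. side H y = 0 \<or> side H y = side H x)"
proof
  assume y: "y \<in> closure (sign_cell \<A> x)"
  show "\<forall>H\<in>\<A>. side H y = 0 \<or> side H y = side H x"
  proof
    fix H assume "H \<in> \<A>"
    obtain a b where H: "hyperplane_function H = (\<lambda>x. a \<bullet> x - b)"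
      using arrangement_hyperplane[OF assms \<open>H \<in> \<A>\<close>] by (rule hyperplane_function) (rule that)
    have "{y. side H y = 0 \<or> side H y = side H x} = (if a \<bullet> x = b then {y. a \<bullet> y = b}
        else if a \<bullet> x < b then {y. a \<bullet> y \<le> b} else {y. a \<bullet> y \<ge> b})"
      by (auto simp: H sgn_if split: if_splits)
    then have "closed {y. side H y = 0 \<or> side H y = side H x}"
      by (simp add: closed_hyperplane closed_halfspace_le closed_halfspace_ge)
    moreover have "sign_cell \<A> x \<subseteq> {y. side H y = 0 \<or> side H y = side H x}"
      using \<open>H \<in> \<A>\<close> by (auto simp: mem_sign_cell[OF assms])
    ultimately show "side H y = 0 \<or> side H y = side H x"
      using closure_minimal y by blast
  qed
next
  assume y: "\<forall>H\<in>\<A>. side H y = 0 \<or> side H y = side H x"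
  have "y + inverse (real (Suc n)) *\<^sub>R (x - y) \<in> sign_cell \<A> x" (is "?z n \<in> _") for n
    unfolding mem_sign_cell[OF assms]
  proof
    fix H assume "H \<in> \<A>"
    then show "side H (y + inverse (real (Suc n)) *\<^sub>R (x - y)) = side H x"
      using y sgn_convex_combination[of "inverse (real (Suc n))"]
      by (simp add: hyperplane_function_affine arrangement_hyperplane[OF assms] inverse_le_1_iff)
  qed
  then show "y \<in> closure (sign_cell \<A> x)"
    unfolding closure_sequential by (intro exI[of _ ?z] conjI allI segment_tendsto)
qed

lemma arrangement_at_sign_cell:
  assumes "arrangement \<A>"
  shows "arrangement_at \<A> (sign_cell \<A> f) = {H \<in> \<A>. side H f = 0}"
proof -
  have "affine hull (sign_cell \<A> f) \<subseteq> H \<longleftrightarrow> side H f = 0" if "H \<in> \<A>" for H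
  proof
    note H = arrangement_hyperplane[OF assms that]
    show "side H f = 0" if "affine hull (sign_cell \<A> f) \<subseteq> H"
      using that sign_cell_self[OF assms, of f] hull_subset[of "sign_cell \<A> f" affine]
        mem_hyperplane_iff[OF H, of f] by (auto simp: sgn_0_0)
    assume "side H f = 0"
    then have "side H x = 0" if "x \<in> sign_cell \<A> f" for x
      using that mem_sign_cell[OF assms] \<open>H \<in> \<A>\<close> by metis
    then have "sign_cell \<A> f \<subseteq> H"
      using mem_hyperplane_iff[OF H] by (auto simp: sgn_0_0)
    moreover have "affine H"
      using H by (auto simp: hyperplane_def affine_hyperplane)
    ultimately show "affine hull (sign_cell \<A> f) \<subseteq> H"
      by (rule hull_minimal)
  qed
  then show ?thesis
    by (auto simp: arrangement_at_def)
qed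

text \<open>Move from f slightly towards c: nonzero signs at f persist by continuity, while on a
  hyperplane through f the sign of c appears at once. Each hyperplane is satisfied eventually, so
  finiteness of \<A> yields one point for all.\<close>

lemma exists_perturbation:
  assumes "arrangement \<A>"
  obtains z where "\<forall>H\<in>\<A>. side H z = (if side H f = 0 then side H c else side H f)"
proof -
  define z where "z n = f + inverse (real (Suc n)) *\<^sub>R (c - f)" for n
  have "\<forall>\<^sub>F n in sequentially. side H (z n) = (if side H f = 0 then side H c else side H f)"
    if "H \<in> \<A>" for H
  proof -
    note H = arrangement_hyperplane[OF assms that]
    have lim: "(\<lambda>n. hyperplane_function H (z n)) \<longlonglongrightarrow> hyperplane_function H f"
    proof -
      obtain a b where "hyperplane_function H = (\<lambda>x. a \<bullet> x - b)"
        using H by (rule hyperplane_function) (rule that)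
      then show ?thesis
        by (simp only: z_def tendsto_diff tendsto_inner tendsto_const segment_tendsto)
    qed
    show ?thesis
    proof (cases "hyperplane_function H f" "0 :: real" rule: linorder_cases)
      case less
      then show ?thesis
        using order_tendstoD(2)[OF lim less] by (auto elim!: eventually_mono)
    next
      case equal
      then have "hyperplane_function H (z n) = inverse (real (Suc n)) * hyperplane_function H c" for n
        by (simp add: z_def hyperplane_function_affine[OF H])
      then show ?thesis
        using equal by (simp add: sgn_mult)
    next
      case greater
      then show ?thesis
        using order_tendstoD(1)[OF lim greater] by (auto elim!: eventually_mono)
    qed
  qed
  then have "\<forall>\<^sub>F n in sequentially.
      \<forall>H\<in>\<A>. side H (z n) = (if side H f = 0 then side H c else side H f)"
    using assms by (intro eventually_ball_finite) (auto simp: arrangement_def)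
  then show ?thesis
    using that eventually_happens'[OF sequentially_bot] by blast
qed

text \<open>The two conditions defining C_F divide the hyperplanes between them. Sharing a chamber
  of the arrangement at F fixes the signs on hyperplanes containing F (\<open>on\<close>); having F
  in the closure fixes all others (\<open>off\<close>).\<close>

lemma chamber_at_sign_cell:
  assumes arr: "arrangement \<A>" and c: "c \<notin> \<Union>\<A>"
  obtains z where "z \<notin> \<Union>\<A>" "chamber_at \<A> (sign_cell \<A> c) (sign_cell \<A> f) = sign_cell \<A> z"
    "\<forall>H\<in>\<A>. side H z = (if side H f = 0 then side H c else side H f)"
proof -
  obtain z where z: "\<forall>H\<in>\<A>. side H z = (if side H f = 0 then side H c else side H f)"
    using exists_perturbation[OF arr] .
  have c': "\<forall>H\<in>\<A>. side H c \<noteq> 0"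
    using c generic_iff[OF arr] by blast
  have generic: "z \<notin> \<Union>\<A>"
    unfolding generic_iff[OF arr] using c' z by simp
  let ?B = "{H \<in> \<A>. side H f = 0}"
  have B: "arrangement ?B"
    using arr by (auto simp: arrangement_def)
  have "chamber_at \<A> (sign_cell \<A> c) (sign_cell \<A> f) = sign_cell \<A> z"
    unfolding chamber_at_def arrangement_at_sign_cell[OF arr]
  proof (rule the_equality, intro conjI)
    show "sign_cell \<A> z \<in> chambers \<A>"
      using generic by (rule sign_cell_chamber[OF arr])
    show "sign_cell \<A> f \<subseteq> closure (sign_cell \<A> z)"
      using z by (auto simp: mem_closure_sign_cell[OF arr] mem_sign_cell[OF arr])
    show "\<exists>K\<in>chambers ?B. sign_cell \<A> c \<subseteq> K \<and> sign_cell \<A> z \<subseteq> K"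
    proof (intro bexI conjI)
      show "sign_cell ?B c \<in> chambers ?B"
        using c by (intro sign_cell_chamber[OF B]) auto
      show "sign_cell \<A> c \<subseteq> sign_cell ?B c" "sign_cell \<A> z \<subseteq> sign_cell ?B c"
        using z by (auto simp: mem_sign_cell[OF arr] mem_sign_cell[OF B])
    qed
  next
    fix D assume D: "D \<in> chambers \<A> \<and> sign_cell \<A> f \<subseteq> closure D \<and>
      (\<exists>K\<in>chambers ?B. sign_cell \<A> c \<subseteq> K \<and> D \<subseteq> K)"
    then have "D \<in> chambers \<A>"
      by (rule conjunct1)
    then obtain d where d: "D = sign_cell \<A> d"
      using chambers_iff[OF arr, of D] by auto
    obtain K where K: "K \<in> chambers ?B" "sign_cell \<A> c \<subseteq> K" "D \<subseteq> K"
      using D by auto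
    obtain k where k: "K = sign_cell ?B k"
      using K(1) chambers_iff[OF B, of K] by auto
    have "c \<in> sign_cell ?B k" "d \<in> sign_cell ?B k"
      using K sign_cell_self[OF arr, of c] sign_cell_self[OF arr, of d] k d by auto
    then have on: "side H d = side H c" if "H \<in> \<A>" "side H f = 0" for H
      using that mem_sign_cell[OF B] by simp
    have "f \<in> closure (sign_cell \<A> d)"
      using D d sign_cell_self[OF arr, of f] by auto
    then have off: "side H d = side H f" if "H \<in> \<A>" "side H f \<noteq> 0" for H
      using that mem_closure_sign_cell[OF arr] by metis
    have "\<forall>H\<in>\<A>. side H d = side H z"
      using on off z by auto
    then show "D = sign_cell \<A> z"
      using sign_cell_eq_iff[OF arr] d by blast
  qed
  then show ?thesis
    using that generic z by blast
qed

text \<open>Going up in the face order replaces signs by zeros and never flips them.\<close>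

lemma face_le_sign_cell:
  assumes "arrangement \<A>" "face_le (sign_cell \<A> x) (sign_cell \<A> y)" "H \<in> \<A>"
  shows "side H y = 0 \<or> side H y = side H x"
proof -
  have "y \<in> closure (sign_cell \<A> x)"
    using assms(2) sign_cell_self[OF assms(1), of y] closure_subset by (auto simp: face_le_def)
  then show ?thesis
    using assms(1,3) mem_closure_sign_cell by blast
qed

section \<open>Separating hyperplanes and iterated C_F\<close>

abbreviation separators :: "'a::euclidean_space set set \<Rightarrow> 'a set \<Rightarrow> 'a set \<Rightarrow> 'a set set" where
  "separators \<A> A B \<equiv> {H \<in> \<A>. separates H A B}"

lemma separators_sign_cell:
  assumes "arrangement \<A>"
  shows "separators \<A> (sign_cell \<A> x) (sign_cell \<A> y) = {H \<in> \<A>. side H x \<noteq> side H y}"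
proof -
  have "separates H (sign_cell \<A> x) (sign_cell \<A> y) \<longleftrightarrow> side H x \<noteq> side H y" if "H \<in> \<A>" for H
  proof
    assume "separates H (sign_cell \<A> x) (sign_cell \<A> y)"
    then have "\<not> same_side H x y"
      using sign_cell_self[OF assms] unfolding separates_def by blast
    then show "side H x \<noteq> side H y"
      using same_side_iff arrangement_hyperplane[OF assms that] by blast
  next
    assume "side H x \<noteq> side H y"
    then show "separates H (sign_cell \<A> x) (sign_cell \<A> y)"
      using that assms
      by (auto simp: separates_def mem_sign_cell same_side_iff arrangement_hyperplane)
  qed
  then show ?thesis
    by auto
qed

lemma chamber_at_chamber:
  assumes "arrangement \<A>" "C \<in> chambers \<A>" "F \<in> faces \<A>"
  shows "chamber_at \<A> C F \<in> chambers \<A>"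
proof -
  obtain c f where c: "c \<notin> \<Union>\<A>" "C = sign_cell \<A> c" and f: "F = sign_cell \<A> f"
    using assms chambers_iff[OF assms(1)] unfolding faces_eq by blast
  show ?thesis
    unfolding c f
    by (rule chamber_at_sign_cell[OF assms(1) c(1), of f]) (simp add: sign_cell_chamber[OF assms(1)])
qed

lemma chamber_at_self:
  assumes "arrangement \<A>" "C \<in> chambers \<A>" "F \<in> faces \<A>" "face_le C F"
  shows "chamber_at \<A> C F = C"
proof -
  obtain c f where c: "c \<notin> \<Union>\<A>" "C = sign_cell \<A> c" and f: "F = sign_cell \<A> f"
    using assms chambers_iff[OF assms(1)] unfolding faces_eq by blast
  obtain z where z: "z \<notin> \<Union>\<A>" "chamber_at \<A> C F = sign_cell \<A> z"
    "\<forall>H\<in>\<A>. side H z = (if side H f = 0 then side H c else side H f)"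
    using chamber_at_sign_cell[OF assms(1) c(1), of f] unfolding c f .
  have "\<forall>H\<in>\<A>. side H z = side H c"
    using z(3) face_le_sign_cell[OF assms(1), of c f] assms(4) unfolding c f by auto
  then show ?thesis
    using z(2) c(2) sign_cell_eq_iff[OF assms(1)] by simp
qed

text \<open>Functoriality of the diagram before lifting: the first claim gives the right target
  chamber, the second makes lengths add up.\<close>

lemma chamber_at_chamber_at:
  assumes arr: "arrangement \<A>" and "C \<in> chambers \<A>" "F\<^sub>1 \<in> faces \<A>" "F\<^sub>2 \<in> faces \<A>" "face_le F\<^sub>1 F\<^sub>2"
  defines "B \<equiv> chamber_at \<A> C F\<^sub>2"
  shows "chamber_at \<A> B F\<^sub>1 = chamber_at \<A> C F\<^sub>1"
    and "card (separators \<A> C B) + card (separators \<A> B (chamber_at \<A> B F\<^sub>1)) =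
      card (separators \<A> C (chamber_at \<A> B F\<^sub>1))"
proof -
  obtain c f1 f2 where c: "c \<notin> \<Union>\<A>" "C = sign_cell \<A> c"
    and f: "F\<^sub>1 = sign_cell \<A> f1" "F\<^sub>2 = sign_cell \<A> f2"
    using assms chambers_iff[OF arr] unfolding faces_eq by blast
  obtain b where b: "b \<notin> \<Union>\<A>" "B = sign_cell \<A> b"
    "\<forall>H\<in>\<A>. side H b = (if side H f2 = 0 then side H c else side H f2)"
    using chamber_at_sign_cell[OF arr c(1), of f2] unfolding B_def c f .
  obtain d where d: "d \<notin> \<Union>\<A>" "chamber_at \<A> B F\<^sub>1 = sign_cell \<A> d"
    "\<forall>H\<in>\<A>. side H d = (if side H f1 = 0 then side H b else side H f1)"
    using chamber_at_sign_cell[OF arr b(1), of f1] unfolding b(2) f .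
  obtain e where e: "e \<notin> \<Union>\<A>" "chamber_at \<A> C F\<^sub>1 = sign_cell \<A> e"
    "\<forall>H\<in>\<A>. side H e = (if side H f1 = 0 then side H c else side H f1)"
    using chamber_at_sign_cell[OF arr c(1), of f1] unfolding c f .
  have le: "side H f2 = 0 \<or> side H f2 = side H f1" if "H \<in> \<A>" for H
    using face_le_sign_cell[OF arr _ that] assms(5) unfolding f by blast
  have "\<forall>H\<in>\<A>. side H d = side H e"
  proof
    fix H assume "H \<in> \<A>"
    then show "side H d = side H e"
      using b(3) d(3) e(3) le[of H] by auto
  qed
  then show "chamber_at \<A> B F\<^sub>1 = chamber_at \<A> C F\<^sub>1"
    using d(2) e(2) sign_cell_eq_iff[OF arr] by simp
  have sep: "separators \<A> C B = {H \<in> \<A>. side H c \<noteq> side H b}"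
    "separators \<A> B (chamber_at \<A> B F\<^sub>1) = {H \<in> \<A>. side H b \<noteq> side H d}"
    "separators \<A> C (chamber_at \<A> B F\<^sub>1) = {H \<in> \<A>. side H c \<noteq> side H d}"
    unfolding c(2) b(2) d(2)[unfolded b(2)] using separators_sign_cell[OF arr] by auto
  \<comment> \<open>If b differs from c at H, then b has the nonzero sign of f2 there; f1 shares
    this sign by \<open>le\<close>, so passing on to d changes nothing.\<close>
  have key: "side H c = side H b \<or> side H b = side H d" if "H \<in> \<A>" for H
    using b(3) d(3) le[OF that] that by auto
  have "{H \<in> \<A>. side H c \<noteq> side H d} =
      {H \<in> \<A>. side H c \<noteq> side H b} \<union> {H \<in> \<A>. side H b \<noteq> side H d}"
    (is "?L = ?R")
  proof (rule set_eqI)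
    show "H \<in> ?L \<longleftrightarrow> H \<in> ?R" for H
      using key[of H] by auto
  qed
  moreover have "{H \<in> \<A>. side H c \<noteq> side H b} \<inter> {H \<in> \<A>. side H b \<noteq> side H d} = {}"
    using key by auto
  moreover have "finite \<A>"
    using arr by (simp add: arrangement_def)
  ultimately show "card (separators \<A> C B) + card (separators \<A> B (chamber_at \<A> B F\<^sub>1)) =
      card (separators \<A> C (chamber_at \<A> B F\<^sub>1))"
    unfolding sep by (simp add: card_Un_disjoint)
qed

section \<open>Galleries\<close>

text \<open>With denominators cleared, the equation says that the line from x to d meets H and H' at
  the same parameter. It is linear in x, and it could hold identically only if the equations of H
  and H' were proportional.\<close>

lemma negligible_equal_crossing:
  assumes "hyperplane H" "hyperplane H'" "H \<noteq> H'" "d \<notin> H" "d \<notin> H'"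
  shows "negligible {x. hyperplane_function H x * hyperplane_function H' d =
    hyperplane_function H' x * hyperplane_function H d}"
proof -
  obtain a b where ab: "H = {x. a \<bullet> x = b}" "hyperplane_function H = (\<lambda>x. a \<bullet> x - b)"
    using assms(1) by (rule hyperplane_function) (rule that)
  obtain a' b' where ab': "H' = {x. a' \<bullet> x = b'}" "hyperplane_function H' = (\<lambda>x. a' \<bullet> x - b')"
    using assms(2) by (rule hyperplane_function) (rule that)
  define k k' where "k = a' \<bullet> d - b'" and "k' = a \<bullet> d - b"
  have k: "k \<noteq> 0" "k' \<noteq> 0"
    using assms(4,5) by (auto simp: k_def k'_def ab ab')
  let ?v = "k *\<^sub>R a - k' *\<^sub>R a'" and ?w = "k * b - k' * b'"
  \<comment> \<open>For parallel hyperplanes \<open>?v\<close> may vanish; then \<open>?w\<close>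
    does not, and the solution set is empty.\<close>
  have "?v \<noteq> 0 \<or> ?w \<noteq> 0"
  proof (rule ccontr)
    assume "\<not> (?v \<noteq> 0 \<or> ?w \<noteq> 0)"
    then have eq: "k *\<^sub>R a = k' *\<^sub>R a'" "k * b = k' * b'"
      by auto
    have "a \<bullet> x = b \<longleftrightarrow> a' \<bullet> x = b'" for x
    proof -
      have "k * (a \<bullet> x) = k' * (a' \<bullet> x)"
        using arg_cong[OF eq(1), of "\<lambda>u. u \<bullet> x"] by simp
      then show ?thesis
        using k eq(2) by (metis mult_cancel_left)
    qed
    then show False
      using assms(3) ab(1) ab'(1) by simp
  qed
  then have "negligible {x. ?v \<bullet> x = ?w}"
    by (rule negligible_hyperplane)
  moreover have "{x. hyperplane_function H x * hyperplane_function H' d =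
    hyperplane_function H' x * hyperplane_function H d} = {x. ?v \<bullet> x = ?w}"
    unfolding ab(2) ab'(2) k_def k'_def by (auto simp: inner_diff_left algebra_simps)
  ultimately show ?thesis
    by simp
qed

text \<open>Moving the starting point within its chamber, the segment to \<open>d\<close> crosses the separating
  hyperplanes one at a time; the point \<open>p\<close> lies just behind the first crossing.\<close>

lemma exists_adjacent_chamber:
  assumes arr: "arrangement \<A>" and c: "c \<notin> \<Union>\<A>" and d: "d \<notin> \<Union>\<A>"
    and ne: "{H \<in> \<A>. side H c \<noteq> side H d} \<noteq> {}"
  obtains p H\<^sub>0 where "p \<notin> \<Union>\<A>" "{H \<in> \<A>. side H c \<noteq> side H p} = {H\<^sub>0}"
    "side H\<^sub>0 c \<noteq> side H\<^sub>0 d"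
proof -
  define S where "S = {H \<in> \<A>. side H c \<noteq> side H d}"
  have fin: "finite \<A>" "finite S"
    using arr by (auto simp: arrangement_def S_def)
  define N where "N H H' = {x. hyperplane_function H x * hyperplane_function H' d =
    hyperplane_function H' x * hyperplane_function H d}" for H H'
  have "negligible (\<Union>(H, H')\<in>{(H, H'). H \<in> \<A> \<and> H' \<in> \<A> \<and> H \<noteq> H'}. N H H')"
  proof (rule negligible_Union)
    have "finite {(H, H'). H \<in> \<A> \<and> H' \<in> \<A> \<and> H \<noteq> H'}"
      by (rule finite_subset[of _ "\<A> \<times> \<A>"]) (use fin(1) in auto)
    then show "finite ((\<lambda>(H, H'). N H H') ` {(H, H'). H \<in> \<A> \<and> H' \<in> \<A> \<and> H \<noteq> H'})"
      by simp
  qed (use d in \<open>auto simp: N_def arrangement_hyperplane[OF arr] intro!: negligible_equal_crossing\<close>)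
  moreover have "open (sign_cell \<A> c)"
  proof -
    have "closed H" if "H \<in> \<A>" for H
      using arrangement_hyperplane[OF arr that] by (auto simp: hyperplane_def closed_hyperplane)
    then have "open (- \<Union>\<A>)"
      using fin(1) by (intro open_Compl closed_Union) auto
    then show ?thesis
      using sign_cell_chamber[OF arr c] unfolding chambers_def by (rule open_components)
  qed
  moreover have "sign_cell \<A> c \<noteq> {}"
    using sign_cell_self[OF arr] by blast
  \<comment> \<open>A nonempty open set is not null, so some a in the chamber of c has no coinciding
    crossings.\<close>
  ultimately have "\<not> sign_cell \<A> c \<subseteq> (\<Union>(H, H')\<in>{(H, H'). H \<in> \<A> \<and> H' \<in> \<A> \<and> H \<noteq> H'}. N H H')"
    using open_not_negligible negligible_subset by blast
  then obtain a where a: "a \<in> sign_cell \<A> c" "\<And>H H'. H \<in> \<A> \<Longrightarrow> H' \<in> \<A> \<Longrightarrow> H \<noteq> H' \<Longrightarrow> a \<notin> N H H'"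
    by blast
  have side_a: "side H a = side H c" if "H \<in> \<A>" for H
    using a(1) that mem_sign_cell[OF arr] by blast
  \<comment> \<open>Along \<open>a + t *\<^sub>R (d - a)\<close> the function of H is its value at a
    minus \<open>h H * t\<close>; thus a separating H is crossed at parameter
    \<open>r H\<close>.\<close>
  define h where "h H = hyperplane_function H a - hyperplane_function H d" for H
  define r where "r H = hyperplane_function H a / h H" for H
  have signs: "side H c \<noteq> 0" "side H d \<noteq> 0" if "H \<in> \<A>" for H
    using c d that generic_iff[OF arr] by blast+
  have opposite: "hyperplane_function H a > 0 \<and> hyperplane_function H d < 0 \<or>
      hyperplane_function H a < 0 \<and> hyperplane_function H d > 0" if "H \<in> S" for H
    using signs[of H] side_a[of H] that by (auto simp: S_def sgn_if split: if_splits)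
  have h: "sgn (h H) = side H a" "h H \<noteq> 0" "0 < r H" "r H < 1" if "H \<in> S" for H
    using opposite[OF that] by (auto simp: h_def r_def divide_simps)
  have r_inj: "H = H'" if "H \<in> S" "H' \<in> S" "r H = r H'" for H H'
  proof (rule ccontr)
    assume "H \<noteq> H'"
    then have "a \<notin> N H H'"
      using that a(2) by (auto simp: S_def)
    moreover have "hyperplane_function H a * h H' = hyperplane_function H' a * h H"
      using that(3) h(2)[OF that(1)] h(2)[OF that(2)] by (simp add: r_def frac_eq_eq)
    ultimately show False
      by (simp add: h_def N_def algebra_simps)
  qed
  define r\<^sub>0 where "r\<^sub>0 = Min (r ` S)"
  have "r\<^sub>0 \<in> r ` S"
    unfolding r\<^sub>0_def using fin(2) ne by (intro Min_in) (auto simp: S_def)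
  then obtain H\<^sub>0 where H\<^sub>0: "H\<^sub>0 \<in> S" "r H\<^sub>0 = r\<^sub>0"
    by auto
  have r\<^sub>0_less: "r\<^sub>0 < r H" if "H \<in> S - {H\<^sub>0}" for H
  proof -
    have "r\<^sub>0 \<le> r H"
      unfolding r\<^sub>0_def using that fin(2) by auto
    moreover have "r\<^sub>0 \<noteq> r H"
      using r_inj[OF H\<^sub>0(1), of H] H\<^sub>0(2) that by auto
    ultimately show ?thesis
      by simp
  qed
  \<comment> \<open>The second crossing, or the end of the segment if there is none; the inserted 1
    keeps the minimum defined. The midpoint t then lies behind exactly one crossing.\<close>
  define m where "m = Min (insert 1 (r ` (S - {H\<^sub>0})))"
  have m: "r\<^sub>0 < m" "m \<le> 1" "\<And>H. H \<in> S - {H\<^sub>0} \<Longrightarrow> m \<le> r H"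
    using fin(2) r\<^sub>0_less h(4)[OF H\<^sub>0(1)] H\<^sub>0(2) by (auto simp: m_def)
  define t where "t = (r\<^sub>0 + m) / 2"
  have t: "r\<^sub>0 < t" "t < m" "0 < t" "t \<le> 1"
    using m(1,2) h(3)[OF H\<^sub>0(1)] H\<^sub>0(2) by (auto simp: t_def)
  define p where "p = a + t *\<^sub>R (d - a)"
  have fp: "hyperplane_function H p =
      (1 - t) * hyperplane_function H a + t * hyperplane_function H d" if "H \<in> \<A>" for H
    unfolding p_def by (rule hyperplane_function_affine[OF arrangement_hyperplane[OF arr that]])
  have fp': "side H p = side H a * sgn (r H - t)" if "H \<in> S" for H
  proof -
    have "hyperplane_function H p = hyperplane_function H a - h H * t"
      using fp[of H] that by (simp add: S_def h_def algebra_simps)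
    moreover have "h H * r H = hyperplane_function H a"
      using h(2)[OF that] by (simp add: r_def)
    ultimately have "hyperplane_function H p = h H * (r H - t)"
      by (simp add: right_diff_distrib)
    then show ?thesis
      using h(1)[OF that] by (simp add: sgn_mult)
  qed
  have same: "side H p = side H c" if H: "H \<in> \<A>" "H \<noteq> H\<^sub>0" for H
  proof (cases "H \<in> S")
    case True
    then have "t < r H"
      using m(3)[of H] t(2) H(2) by force
    then show ?thesis
      using fp'[OF True] side_a[OF H(1)] by simp
  next
    case False
    then have "side H a = side H d"
      using H(1) side_a by (simp add: S_def)
    then show ?thesis
      using fp[OF H(1)] sgn_convex_combination[OF t(3,4)] side_a[OF H(1)] by simp
  qed
  have flip: "side H\<^sub>0 p = - side H\<^sub>0 c"
    using fp'[OF H\<^sub>0(1)] H\<^sub>0 t(1) side_a[of H\<^sub>0] by (simp add: S_def)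
  have H\<^sub>0_in: "H\<^sub>0 \<in> \<A>" "side H\<^sub>0 c \<noteq> side H\<^sub>0 d"
    using H\<^sub>0(1) by (auto simp: S_def)
  have "\<forall>H\<in>\<A>. side H p \<noteq> 0"
    using same flip signs(1) by (metis neg_equal_0_iff_equal)
  then have "p \<notin> \<Union>\<A>"
    using generic_iff[OF arr] by blast
  moreover have "{H \<in> \<A>. side H c \<noteq> side H p} = {H\<^sub>0}"
  proof (rule set_eqI)
    show "H \<in> {H \<in> \<A>. side H c \<noteq> side H p} \<longleftrightarrow> H \<in> {H\<^sub>0}" for H
      using same[of H] flip signs(1)[OF H\<^sub>0_in(1)] H\<^sub>0_in(1) by (cases "H = H\<^sub>0") auto
  qed
  ultimately show ?thesis
    using that H\<^sub>0_in(2) by blast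
qed

text \<open>Each step crosses one of the hyperplanes still separating c from d and no other, so
  their number drops by exactly one and the gallery wastes no edge.\<close>

lemma exists_gallery:
  assumes arr: "arrangement \<A>" and "c \<notin> \<Union>\<A>" and d: "d \<notin> \<Union>\<A>"
  shows "\<exists>xs. is_walk (chamber_graph \<A>) (sign_cell \<A> c) xs \<and> walk_end (sign_cell \<A> c) xs = sign_cell \<A> d \<and>
    (\<forall>x\<in>set xs. snd x) \<and> length xs = card {H \<in> \<A>. side H c \<noteq> side H d}"
  using assms(2)
proof (induction "card {H \<in> \<A>. side H c \<noteq> side H d}" arbitrary: c)
  case 0
  then have "{H \<in> \<A>. side H c \<noteq> side H d} = {}"
    using arr by (simp add: arrangement_def)
  then have "sign_cell \<A> c = sign_cell \<A> d"
    using sign_cell_eq_iff[OF arr] by blast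
  then show ?case
    using sign_cell_chamber[OF arr "0.prems"] "0.hyps"
    by (intro exI[of _ "[]"]) (simp add: chamber_graph_def)
next
  case (Suc n)
  then have "{H \<in> \<A>. side H c \<noteq> side H d} \<noteq> {}"
    by (metis card.empty nat.distinct(1))
  then obtain p H\<^sub>0 where p: "p \<notin> \<Union>\<A>" "{H \<in> \<A>. side H c \<noteq> side H p} = {H\<^sub>0}"
      "side H\<^sub>0 c \<noteq> side H\<^sub>0 d"
    using exists_adjacent_chamber[OF arr Suc.prems d] by blast
  have fin: "finite {H \<in> \<A>. side H c \<noteq> side H d}"
    using arr by (simp add: arrangement_def)
  have H\<^sub>0: "H\<^sub>0 \<in> \<A>" "side H\<^sub>0 c \<noteq> side H\<^sub>0 p"
    using p(2) by auto
  \<comment> \<open>There are only two nonzero signs, and p and d both differ from c here.\<close>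
  have "side H\<^sub>0 p = side H\<^sub>0 d"
    using p(1,3) d Suc.prems H\<^sub>0 generic_iff[OF arr] by (auto simp: sgn_if split: if_splits)
  have "{H \<in> \<A>. side H p \<noteq> side H d} = {H \<in> \<A>. side H c \<noteq> side H d} - {H\<^sub>0}"
    (is "?L = ?R")
  proof (rule set_eqI)
    fix H
    have "side H c = side H p" if "H \<in> \<A>" "H \<noteq> H\<^sub>0"
      using p(2) that by auto
    then show "H \<in> ?L \<longleftrightarrow> H \<in> ?R"
      using \<open>side H\<^sub>0 p = side H\<^sub>0 d\<close> by (cases "H = H\<^sub>0") auto
  qed
  then have n: "n = card {H \<in> \<A>. side H p \<noteq> side H d}"
    using Suc.hyps(2) fin H\<^sub>0(1) p(3) by simp
  obtain xs where xs: "is_walk (chamber_graph \<A>) (sign_cell \<A> p) xs"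
      "walk_end (sign_cell \<A> p) xs = sign_cell \<A> d" "\<forall>x\<in>set xs. snd x" "length xs = n"
    using Suc.hyps(1)[OF n p(1)] n by auto
  have "card (separators \<A> (sign_cell \<A> c) (sign_cell \<A> p)) = 1"
    unfolding separators_sign_cell[OF arr] p(2) by simp
  then show ?case
    using xs Suc.hyps(2) Suc.prems p(1) sign_cell_chamber[OF arr]
    by (intro exI[of _ "((sign_cell \<A> c, sign_cell \<A> p), True) # xs"])
      (simp add: chamber_graph_def)
qed

text \<open>A hyperplane separating the two ends must be crossed by some edge, and an edge crosses
  only one.\<close>

lemma card_separators_le_length:
  assumes arr: "arrangement \<A>"
  shows "is_walk (chamber_graph \<A>) A xs \<Longrightarrow> card (separators \<A> A (walk_end A xs)) \<le> length xs"
proof (induction xs arbitrary: A)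
  case Nil
  then obtain a where "A = sign_cell \<A> a"
    using chambers_iff[OF arr] by (auto simp: chamber_graph_def)
  then show ?case
    by (simp add: separators_sign_cell[OF arr])
next
  case (Cons x xs)
  let ?B = "step_target x"
  have walk: "is_walk (chamber_graph \<A>) ?B xs"
    using Cons.prems by simp
  have verts: "A \<in> chambers \<A>" "?B \<in> chambers \<A>" "walk_end ?B xs \<in> chambers \<A>"
    using Cons.prems is_walk_begin[OF walk] walk_end_in_verts[OF walk] by (auto simp: chamber_graph_def)
  then obtain a b c where abc: "A = sign_cell \<A> a" "?B = sign_cell \<A> b"
      "walk_end ?B xs = sign_cell \<A> c"
    using chambers_iff[OF arr] by metis
  obtain P Q s where x: "x = ((P, Q), s)"
    by (metis surj_pair)
  have edge: "card (separators \<A> P Q) = 1"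
    using Cons.prems x by (simp add: chamber_graph_def)
  \<comment> \<open>Separation is symmetric, which covers edges traversed backwards.\<close>
  have "{H \<in> \<A>. side H a \<noteq> side H b} = {H \<in> \<A>. side H b \<noteq> side H a}"
    by auto
  then have one: "card {H \<in> \<A>. side H a \<noteq> side H b} = 1"
    using edge Cons.prems x abc(1,2) separators_sign_cell[OF arr] by (cases s) auto
  have fin: "finite \<A>"
    using arr by (simp add: arrangement_def)
  have "card {H \<in> \<A>. side H a \<noteq> side H c} \<le>
      card ({H \<in> \<A>. side H a \<noteq> side H b} \<union> {H \<in> \<A>. side H b \<noteq> side H c})"
    using fin by (intro card_mono) auto
  also have "\<dots> \<le> 1 + card {H \<in> \<A>. side H b \<noteq> side H c}"
    using card_Un_le[of "{H \<in> \<A>. side H a \<noteq> side H b}" "{H \<in> \<A>. side H b \<noteq> side H c}"] one by simp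
  also have "\<dots> \<le> 1 + length xs"
    using Cons.IH[OF walk] abc(2,3) separators_sign_cell[OF arr, of b c] by simp
  finally show ?case
    using abc separators_sign_cell[OF arr, of a c] by simp
qed

text \<open>The lower bound is attained by a gallery. Minimality thus becomes a count, and a
  concatenation is minimal as soon as the numbers of separating hyperplanes add up.\<close>

lemma minimal_positive_iff:
  assumes arr: "arrangement \<A>" and "A \<in> chambers \<A>" "B \<in> chambers \<A>"
  shows "minimal_positive (chamber_graph \<A>) A B \<alpha> \<longleftrightarrow>
    \<alpha> \<in> opaths (chamber_graph \<A>) \<and> positive_path \<alpha> \<and> path_begin \<alpha> = A \<and> path_end \<alpha> = B \<and>
    path_length \<alpha> = card (separators \<A> A B)"
    and "\<exists>\<alpha>. minimal_positive (chamber_graph \<A>) A B \<alpha>"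
proof -
  obtain a b where ab: "a \<notin> \<Union>\<A>" "A = sign_cell \<A> a" "b \<notin> \<Union>\<A>" "B = sign_cell \<A> b"
    using assms(2,3) unfolding chambers_iff[OF arr] by blast
  obtain xs where "is_walk (chamber_graph \<A>) A xs" "walk_end A xs = B"
    "\<forall>x\<in>set xs. snd x" "length xs = card (separators \<A> A B)"
    using exists_gallery[OF arr ab(1,3)] unfolding ab(2,4) separators_sign_cell[OF arr, of a b] by auto
  then obtain \<gamma> where \<gamma>: "\<gamma> \<in> opaths (chamber_graph \<A>) \<and> positive_path \<gamma> \<and> path_begin \<gamma> = A \<and>
      path_end \<gamma> = B \<and> path_length \<gamma> = card (separators \<A> A B)"
    by (intro that[of "(A, xs)"])
      (simp add: opaths_def positive_path_def path_begin_def path_end_def path_length_def)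
  have lower: "card (separators \<A> A B) \<le> path_length \<beta>"
    if "\<beta> \<in> opaths (chamber_graph \<A>)" "path_begin \<beta> = A" "path_end \<beta> = B" for \<beta>
    using that card_separators_le_length[OF arr, of A "snd \<beta>"]
    by (simp add: opaths_def path_begin_def path_end_def path_length_def)
  have iff: "minimal_positive (chamber_graph \<A>) A B \<alpha> \<longleftrightarrow>
    \<alpha> \<in> opaths (chamber_graph \<A>) \<and> positive_path \<alpha> \<and> path_begin \<alpha> = A \<and> path_end \<alpha> = B \<and>
    path_length \<alpha> = card (separators \<A> A B)" for \<alpha>
  proof
    assume "minimal_positive (chamber_graph \<A>) A B \<alpha>"
    then show "\<alpha> \<in> opaths (chamber_graph \<A>) \<and> positive_path \<alpha> \<and> path_begin \<alpha> = A \<and>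
        path_end \<alpha> = B \<and> path_length \<alpha> = card (separators \<A> A B)"
      unfolding minimal_positive_def using \<gamma> lower[of \<alpha>] by fastforce
  qed (use lower in \<open>auto simp: minimal_positive_def\<close>)
  show "minimal_positive (chamber_graph \<A>) A B \<alpha> \<longleftrightarrow>
    \<alpha> \<in> opaths (chamber_graph \<A>) \<and> positive_path \<alpha> \<and> path_begin \<alpha> = A \<and> path_end \<alpha> = B \<and>
    path_length \<alpha> = card (separators \<A> A B)"
    by (rule iff)
  show "\<exists>\<alpha>. minimal_positive (chamber_graph \<A>) A B \<alpha>"
    using \<gamma> unfolding iff by (rule exI)
qed

section \<open>The covering of poset limits\<close>

lemma minimal_positive_related:
  assumes "minimal_positive (chamber_graph \<A>) A B \<alpha>" "minimal_positive (chamber_graph \<A>) A B \<beta>"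
  shows "(\<alpha>, \<beta>) \<in> chamber_path_rel \<A>"
  using assms unfolding chamber_path_rel_def generated_congruence_def by blast

text \<open>Lifts along the identity are the paths themselves, so the order underlying W involves
  only the chambers C_F.\<close>

lemma lift_end_id:
  assumes "arrangement \<A>" "A \<in> chambers \<A>" "B \<in> chambers \<A>"
  shows "lift_end \<A> (chamber_graph \<A>) id A B = B"
proof -
  define \<alpha> where "\<alpha> = (SOME \<alpha>. minimal_positive (chamber_graph \<A>) (id A) B \<alpha>)"
  have "minimal_positive (chamber_graph \<A>) A B \<alpha>"
    using someI_ex[OF minimal_positive_iff(2)[OF assms]] by (simp add: \<alpha>_def)
  then have \<alpha>: "\<alpha> \<in> opaths (chamber_graph \<A>)" "path_begin \<alpha> = A" "path_end \<alpha> = B"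
    by (auto simp: minimal_positive_def)
  have "path_lift (chamber_graph \<A>) id A \<alpha> = \<alpha>"
    unfolding path_lift_def map_path_id using \<alpha> by (intro the_equality) auto
  then show ?thesis
    using \<alpha>(3) by (simp add: lift_end_def \<alpha>_def)
qed

lemma mem_Plim:
  "(F, v) \<in> Plim \<A> \<Theta> \<rho> \<longleftrightarrow> F \<in> faces \<A> \<and> v \<in> pverts \<Theta> \<and> face_le (\<rho> v) F"
  by (simp add: Plim_def diagram_space_def)

lemma mem_Plim_order:
  "((G, w), (F, v)) \<in> Plim_order \<A> \<Theta> \<rho> \<longleftrightarrow> (G, w) \<in> Plim \<A> \<Theta> \<rho> \<and> (F, v) \<in> Plim \<A> \<Theta> \<rho> \<and>
    face_le G F \<and> w = lift_end \<A> \<Theta> \<rho> v (chamber_at \<A> (\<rho> v) G)"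
  by (simp add: Plim_order_def diagram_map_def)

lemma mem_Plim_id:
  "(F, C) \<in> Plim \<A> (chamber_graph \<A>) id \<longleftrightarrow> F \<in> faces \<A> \<and> C \<in> chambers \<A> \<and> face_le C F"
  by (simp add: mem_Plim chamber_graph_def)

lemma mem_Plim_order_id:
  assumes "arrangement \<A>"
  shows "((G, D), (F, C)) \<in> Plim_order \<A> (chamber_graph \<A>) id \<longleftrightarrow>
    (G, D) \<in> Plim \<A> (chamber_graph \<A>) id \<and> (F, C) \<in> Plim \<A> (chamber_graph \<A>) id \<and>
    face_le G F \<and> D = chamber_at \<A> C G"
  using lift_end_id[OF assms] chamber_at_chamber[OF assms]
  by (auto simp: mem_Plim_order mem_Plim_id)

section \<open>Transport of vertices along minimal positive paths\<close>

locale arrangement_cover =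
  fixes \<A> :: "'a::euclidean_space set set"
    and \<Theta> :: "'v pair_pre_digraph"
    and R :: "'v opath rel"
    and \<rho> :: "'v \<Rightarrow> 'a set"
  assumes arr: "arrangement \<A>"
    and system: "oriented_system \<Theta> R"
    and oriented_cover: "oriented_cover \<Theta> R (chamber_graph \<A>) (chamber_path_rel \<A>) \<rho>"

sublocale arrangement_cover \<subseteq> path_lifting \<Theta> R "chamber_graph \<A>" "chamber_path_rel \<A>" \<rho>
  using oriented_cover system by unfold_locales (auto simp: oriented_system_def)

context arrangement_cover
begin

lemma vertex_chamber: "v \<in> pverts \<Theta> \<Longrightarrow> \<rho> v \<in> chambers \<A>"
  using oriented_cover by (auto simp: oriented_cover_def chamber_graph_def)

text \<open>Frees \<open>lift_end\<close> from its chosen path, since minimal positive paths with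
  common ends are equivalent. A concatenation can then stand in for the chosen path.\<close>

lemma lift_end_eq:
  assumes v: "v \<in> pverts \<Theta>" and \<alpha>: "minimal_positive (chamber_graph \<A>) (\<rho> v) B \<alpha>"
  shows "lift_end \<A> \<Theta> \<rho> v B = path_end (path_lift \<Theta> \<rho> v \<alpha>)"
proof -
  define \<beta> where "\<beta> = (SOME \<alpha>. minimal_positive (chamber_graph \<A>) (\<rho> v) B \<alpha>)"
  have \<beta>: "minimal_positive (chamber_graph \<A>) (\<rho> v) B \<beta>"
    unfolding \<beta>_def using \<alpha> by (rule someI)
  have "path_end (path_lift \<Theta> \<rho> v \<beta>) = path_end (path_lift \<Theta> \<rho> v \<alpha>)"
    using \<alpha> \<beta> by (intro path_lift_end_cong[OF v minimal_positive_related[OF \<beta> \<alpha>]])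
      (auto simp: minimal_positive_def)
  then show ?thesis
    by (simp add: lift_end_def \<beta>_def)
qed

lemma lift_end:
  assumes v: "v \<in> pverts \<Theta>" and B: "B \<in> chambers \<A>"
  shows "lift_end \<A> \<Theta> \<rho> v B \<in> pverts \<Theta>" "\<rho> (lift_end \<A> \<Theta> \<rho> v B) = B"
proof -
  obtain \<alpha> where \<alpha>: "minimal_positive (chamber_graph \<A>) (\<rho> v) B \<alpha>"
    using minimal_positive_iff(2)[OF arr vertex_chamber[OF v] B] ..
  then have "\<alpha> \<in> opaths (chamber_graph \<A>)" "path_begin \<alpha> = \<rho> v" "path_end \<alpha> = B"
    by (auto simp: minimal_positive_def)
  then show "lift_end \<A> \<Theta> \<rho> v B \<in> pverts \<Theta>" "\<rho> (lift_end \<A> \<Theta> \<rho> v B) = B"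
    using path_lift_end[OF v] lift_end_eq[OF v \<alpha>] by auto
qed

lemma lift_end_self:
  assumes v: "v \<in> pverts \<Theta>"
  shows "lift_end \<A> \<Theta> \<rho> v (\<rho> v) = v"
proof -
  have const: "(\<rho> v, []) \<in> opaths (chamber_graph \<A>)"
    using vertex_chamber[OF v] by (simp add: opaths_def chamber_graph_def)
  then have "minimal_positive (chamber_graph \<A>) (\<rho> v) (\<rho> v) (\<rho> v, [])"
    by (simp add: minimal_positive_def positive_path_def path_begin_def path_end_def path_length_def)
  moreover have "path_lift \<Theta> \<rho> v (\<rho> v, []) = (v, [])"
    using v const by (intro path_lift_unique) (auto simp: opaths_def path_begin_def map_path_def)
  ultimately show ?thesis
    using lift_end_eq[OF v] by (simp add: path_end_def)
qed

lemma lift_end_lift_end: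
  assumes v: "v \<in> pverts \<Theta>" and B: "B \<in> chambers \<A>" and C: "C \<in> chambers \<A>"
    and card: "card (separators \<A> (\<rho> v) B) + card (separators \<A> B C) = card (separators \<A> (\<rho> v) C)"
  shows "lift_end \<A> \<Theta> \<rho> (lift_end \<A> \<Theta> \<rho> v B) C = lift_end \<A> \<Theta> \<rho> v C"
proof -
  note A = vertex_chamber[OF v]
  obtain \<alpha> where \<alpha>: "minimal_positive (chamber_graph \<A>) (\<rho> v) B \<alpha>"
    using minimal_positive_iff(2)[OF arr A B] ..
  obtain \<beta> where \<beta>: "minimal_positive (chamber_graph \<A>) B C \<beta>"
    using minimal_positive_iff(2)[OF arr B C] ..
  note \<alpha>' = \<alpha>[unfolded minimal_positive_iff(1)[OF arr A B]]
  note \<beta>' = \<beta>[unfolded minimal_positive_iff(1)[OF arr B C]]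
  have "minimal_positive (chamber_graph \<A>) (\<rho> v) C (\<alpha> \<cdot>\<cdot> \<beta>)"
    unfolding minimal_positive_iff(1)[OF arr A C] using \<alpha>' \<beta>' card
    by (auto simp: path_concat_in_opaths positive_path_concat path_begin_concat path_end_concat
        path_length_concat)
  then have "lift_end \<A> \<Theta> \<rho> v C = path_end (path_lift \<Theta> \<rho> v (\<alpha> \<cdot>\<cdot> \<beta>))"
    by (rule lift_end_eq[OF v])
  also have "\<dots> = path_end (path_lift \<Theta> \<rho> (path_end (path_lift \<Theta> \<rho> v \<alpha>)) \<beta>)"
    using \<alpha>' \<beta>' by (intro path_lift_end_concat[OF v]) auto
  also have "\<dots> = lift_end \<A> \<Theta> \<rho> (lift_end \<A> \<Theta> \<rho> v B) C"
    using lift_end_eq[OF lift_end(1)[OF v B], of C \<beta>] lift_end(2)[OF v B] lift_end_eq[OF v \<alpha>] \<beta>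
    by simp
  finally show ?thesis
    by (rule sym)
qed

text \<open>One minimal path from C to \<open>\<rho> v\<close> computes the transport of all
  vertices over C at once, so the bijection for a single path applies.\<close>

lemma lift_end_bij:
  assumes v: "v \<in> pverts \<Theta>" and C: "C \<in> chambers \<A>"
  shows "\<exists>!w. w \<in> pverts \<Theta> \<and> \<rho> w = C \<and> lift_end \<A> \<Theta> \<rho> w (\<rho> v) = v"
proof -
  obtain \<alpha> where \<alpha>: "minimal_positive (chamber_graph \<A>) C (\<rho> v) \<alpha>"
    using minimal_positive_iff(2)[OF arr C vertex_chamber[OF v]] ..
  then have "\<alpha> \<in> opaths (chamber_graph \<A>)" "path_begin \<alpha> = C" "path_end \<alpha> = \<rho> v"
    by (auto simp: minimal_positive_def)
  then have "\<exists>!w. w \<in> pverts \<Theta> \<and> \<rho> w = C \<and> path_end (path_lift \<Theta> \<rho> w \<alpha>) = v"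
    using path_lift_end_bij[OF v] by blast
  moreover have "lift_end \<A> \<Theta> \<rho> w (\<rho> v) = path_end (path_lift \<Theta> \<rho> w \<alpha>)"
    if "w \<in> pverts \<Theta>" "\<rho> w = C" for w
    using lift_end_eq[OF that(1), of "\<rho> v" \<alpha>] \<alpha> that(2) by simp
  ultimately show ?thesis
    by metis
qed

text \<open>Start at any vertex and lift a gallery from its chamber to C.\<close>

lemma vertex_surj:
  assumes "C \<in> chambers \<A>"
  obtains v where "v \<in> pverts \<Theta>" "\<rho> v = C"
proof -
  have "pverts \<Theta> \<noteq> {}"
    using system by (simp add: oriented_system_def graph_connected_def)
  then obtain v where "v \<in> pverts \<Theta>"
    by auto
  from that[OF lift_end[OF this assms]] show ?thesis .
qed

section \<open>Order and comparabilities of the limit\<close>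

lemma Plim_order_refl:
  assumes "x \<in> Plim \<A> \<Theta> \<rho>"
  shows "(x, x) \<in> Plim_order \<A> \<Theta> \<rho>"
proof -
  obtain F v where x: "x = (F, v)"
    by (rule prod.exhaust)
  with assms have "F \<in> faces \<A>" "v \<in> pverts \<Theta>" "face_le (\<rho> v) F"
    by (auto simp: mem_Plim)
  then show ?thesis
    using assms chamber_at_self[OF arr vertex_chamber] lift_end_self
    by (simp add: x mem_Plim_order face_le_def)
qed

text \<open>Functoriality of the lifted diagram: transport to the chamber at
  \<open>F\<^sub>2\<close> and then at \<open>F\<^sub>1\<close> equals direct transport, because the
  two minimal paths compose to a minimal one.\<close>

lemma Plim_order_trans:
  assumes "(x, y) \<in> Plim_order \<A> \<Theta> \<rho>" "(y, z) \<in> Plim_order \<A> \<Theta> \<rho>"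
  shows "(x, z) \<in> Plim_order \<A> \<Theta> \<rho>"
proof -
  obtain F\<^sub>1 F\<^sub>2 F\<^sub>3 v\<^sub>1 v\<^sub>2 v\<^sub>3 where xyz: "x = (F\<^sub>1, v\<^sub>1)" "y = (F\<^sub>2, v\<^sub>2)" "z = (F\<^sub>3, v\<^sub>3)"
    by (metis surj_pair)
  have mem: "(F\<^sub>1, v\<^sub>1) \<in> Plim \<A> \<Theta> \<rho>" "(F\<^sub>2, v\<^sub>2) \<in> Plim \<A> \<Theta> \<rho>" "(F\<^sub>3, v\<^sub>3) \<in> Plim \<A> \<Theta> \<rho>"
    and le: "face_le F\<^sub>1 F\<^sub>2" "face_le F\<^sub>2 F\<^sub>3"
    and v: "v\<^sub>1 = lift_end \<A> \<Theta> \<rho> v\<^sub>2 (chamber_at \<A> (\<rho> v\<^sub>2) F\<^sub>1)"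
      "v\<^sub>2 = lift_end \<A> \<Theta> \<rho> v\<^sub>3 (chamber_at \<A> (\<rho> v\<^sub>3) F\<^sub>2)"
    using assms unfolding xyz mem_Plim_order by auto
  have F: "F\<^sub>1 \<in> faces \<A>" "F\<^sub>2 \<in> faces \<A>" and v\<^sub>3: "v\<^sub>3 \<in> pverts \<Theta>"
    using mem by (auto simp: mem_Plim)
  note A = vertex_chamber[OF v\<^sub>3]
  note B = chamber_at_chamber[OF arr A F(2)]
  note C = chamber_at_chamber[OF arr B F(1)]
  note add = chamber_at_chamber_at[OF arr A F le(1)]
  have "v\<^sub>1 = lift_end \<A> \<Theta> \<rho> v\<^sub>2 (chamber_at \<A> (chamber_at \<A> (\<rho> v\<^sub>3) F\<^sub>2) F\<^sub>1)"
    using v lift_end(2)[OF v\<^sub>3 B] by simp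
  also have "\<dots> = lift_end \<A> \<Theta> \<rho> v\<^sub>3 (chamber_at \<A> (chamber_at \<A> (\<rho> v\<^sub>3) F\<^sub>2) F\<^sub>1)"
    unfolding v(2) by (rule lift_end_lift_end[OF v\<^sub>3 B C add(2)])
  finally show ?thesis
    using mem le add(1) unfolding xyz mem_Plim_order by (auto simp: face_le_def)
qed

text \<open>Below an element the lift is forced, being the image of v under a diagram map. Above it,
  v is itself the image, and \<open>lift_end_bij\<close> gives its unique preimage over C.\<close>

lemma simplicial_covering_W_complex:
  "simplicial_covering (W_complex \<A> \<Theta> \<rho>) (W_complex \<A> (chamber_graph \<A>) id) (\<lambda>(F, v). (F, \<rho> v))"
  (is "simplicial_covering _ _ ?f")
  unfolding W_complex_def
proof (rule simplicial_covering_order_complex)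
  let ?P = "Plim \<A> \<Theta> \<rho>" and ?r = "Plim_order \<A> \<Theta> \<rho>"
  let ?Q = "Plim \<A> (chamber_graph \<A>) id" and ?s = "Plim_order \<A> (chamber_graph \<A>) id"
  have base: "(F, \<rho> v) \<in> ?Q" if "(F, v) \<in> ?P" for F v
    using that vertex_chamber by (auto simp: mem_Plim chamber_graph_def)
  show "?f ` ?P = ?Q"
  proof
    show "?Q \<subseteq> ?f ` ?P"
    proof
      fix y assume y: "y \<in> ?Q"
      obtain F C where FC: "y = (F, C)"
        by (rule prod.exhaust)
      with y have F: "F \<in> faces \<A>" "face_le C F" and C: "C \<in> chambers \<A>"
        by (auto simp: mem_Plim_id)
      obtain v where v: "v \<in> pverts \<Theta>" "\<rho> v = C"
        using C by (rule vertex_surj)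
      then have "(F, v) \<in> ?P"
        using F by (simp add: mem_Plim)
      then show "y \<in> ?f ` ?P"
        using v(2) FC by (intro image_eqI[of _ _ "(F, v)"]) auto
    qed
  qed (use base in auto)
  show "?r \<subseteq> ?P \<times> ?P" "?s \<subseteq> ?Q \<times> ?Q"
    by (auto simp: Plim_order_def)
  show "(?f x, ?f y) \<in> ?s" if "(x, y) \<in> ?r" for x y
  proof -
    obtain G w F v where xy: "x = (G, w)" "y = (F, v)"
      by (metis surj_pair)
    have r: "(G, w) \<in> ?P" "(F, v) \<in> ?P" "face_le G F"
      "w = lift_end \<A> \<Theta> \<rho> v (chamber_at \<A> (\<rho> v) G)"
      using that by (auto simp: xy mem_Plim_order)
    then have "\<rho> w = chamber_at \<A> (\<rho> v) G"
      using lift_end(2) chamber_at_chamber[OF arr vertex_chamber] by (simp add: mem_Plim)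
    then show ?thesis
      using r(3) base[OF r(1)] base[OF r(2)] by (simp add: xy mem_Plim_order_id[OF arr])
  qed
  show "\<exists>!z. (z, x) \<in> ?r \<and> ?f z = y" if "x \<in> ?P" "(y, ?f x) \<in> ?s" for x y
  proof -
    obtain F v G C where xy: "x = (F, v)" "y = (G, C)"
      by (metis surj_pair)
    have v: "v \<in> pverts \<Theta>"
      using that(1) by (simp add: xy mem_Plim)
    have y: "G \<in> faces \<A>" "C \<in> chambers \<A>" "face_le C G" "face_le G F" "C = chamber_at \<A> (\<rho> v) G"
      using that(2) by (auto simp: xy mem_Plim_order_id[OF arr] mem_Plim_id)
    show ?thesis
    proof (rule ex1I)
      show "((G, lift_end \<A> \<Theta> \<rho> v C), x) \<in> ?r \<and> ?f (G, lift_end \<A> \<Theta> \<rho> v C) = y"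
        using lift_end[OF v y(2)] that(1) y by (simp add: xy mem_Plim_order mem_Plim)
      show "z = (G, lift_end \<A> \<Theta> \<rho> v C)" if "(z, x) \<in> ?r \<and> ?f z = y" for z
        using that y(5) by (cases z) (auto simp: xy mem_Plim_order)
    qed
  qed
  show "\<exists>!z. (x, z) \<in> ?r \<and> ?f z = y" if "x \<in> ?P" "(?f x, y) \<in> ?s" for x y
  proof -
    obtain F v G C where xy: "x = (F, v)" "y = (G, C)"
      by (metis surj_pair)
    have v: "v \<in> pverts \<Theta>"
      using that(1) by (simp add: xy mem_Plim)
    have y: "G \<in> faces \<A>" "C \<in> chambers \<A>" "face_le C G" "face_le F G" "\<rho> v = chamber_at \<A> C F"
      using that(2) by (auto simp: xy mem_Plim_order_id[OF arr] mem_Plim_id)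
    \<comment> \<open>Since \<open>\<rho> v\<close> is the chamber of C at F, lying above x means
      exactly that transport from w to \<open>\<rho> v\<close> ends at v.\<close>
    have iff: "(x, (H, w)) \<in> ?r \<and> ?f (H, w) = y \<longleftrightarrow>
        H = G \<and> w \<in> pverts \<Theta> \<and> \<rho> w = C \<and> lift_end \<A> \<Theta> \<rho> w (\<rho> v) = v" for H w
      using that(1) y by (auto simp: xy mem_Plim_order mem_Plim)
    obtain w where w: "w \<in> pverts \<Theta> \<and> \<rho> w = C \<and> lift_end \<A> \<Theta> \<rho> w (\<rho> v) = v"
      "\<forall>w'. w' \<in> pverts \<Theta> \<and> \<rho> w' = C \<and> lift_end \<A> \<Theta> \<rho> w' (\<rho> v) = v \<longrightarrow> w' = w"
      using lift_end_bij[OF v y(2)] by (rule ex1E)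
    show ?thesis
    proof (rule ex1I)
      show "(x, (G, w)) \<in> ?r \<and> ?f (G, w) = y"
        unfolding iff using w(1) by simp
      fix z assume z: "(x, z) \<in> ?r \<and> ?f z = y"
      obtain H w' where Hw': "z = (H, w')"
        by (rule prod.exhaust)
      show "z = (G, w)"
        using z w(2) unfolding Hw' iff by simp
    qed
  qed
qed (use Plim_order_refl Plim_order_trans in blast)+

end

theorem proposition5p2:
  fixes \<A> :: "'a::euclidean_space set set"
    and \<Theta> :: "'v pair_pre_digraph"
    and R :: "'v opath rel"
    and \<rho> :: "'v \<Rightarrow> 'a set"
  assumes "arrangement \<A>"
    and "oriented_system \<Theta> R"
    and "oriented_cover \<Theta> R (chamber_graph \<A>) (chamber_path_rel \<A>) \<rho>"
  shows "covering_map (realization (W_complex \<A> \<Theta> \<rho>))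
           (realization (W_complex \<A> (chamber_graph \<A>) id)) (Lambda \<rho>)"
proof -
  interpret arrangement_cover \<A> \<Theta> R \<rho>
    using assms by unfold_locales
  interpret simplicial_covering "W_complex \<A> \<Theta> \<rho>" "W_complex \<A> (chamber_graph \<A>) id"
    "\<lambda>(F, v). (F, \<rho> v)"
    by (rule simplicial_covering_W_complex)
  show ?thesis
    unfolding Lambda_def by (rule covering_map_realization)
qed

end
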